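(* The class of arithmetical sets $A\subseteq\omega$ such that $K^c\nleq_e A$ is not a splitting class (with respect to $\le_e$).
   Context: An enumeration operator is a map $\Phi:2^\omega\to 2^\omega$ given by a c.e. set $W$ via $\Phi(A)=\{x:(\exists u)[\langle x,u\rangle\in W\ \&\ D_u\subseteq A]\}$, $D_u$ being the finite set with canonical index $u$. $A\le_e B$ iff $A=\Phi(B)$ for some enumeration operator $\Phi$; $A<_e B$ iff $A\le_e B$ and $B\nleq_e A$. $A\oplus B=\{2x:x\in A\}\cup\{2x+1:x\in B\}$. $K$ is the halting set and $K^c=\omega\smallsetminus K$ (whose $e$-degree is the first enumeration jump, the jump of the degree of $\emptyset$). A nonempty, countable, downwards $\le_e$-closed class $\mathcal{A}\subseteq 2^\omega$ is a splitting class if for every $A\in\mathcal{A}$ and every finite $\mathcal{B}\subseteq\{B\in\mathcal{A}:B\nleq_e A\}$ there is $C\in\mathcal{A}$ with $C>_e A$ such that $B\oplus C\notin\mathcal{A}$ for all $B\in\mathcal{B}$. *)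

theory Defs
  imports Main "HOL-Library.Nat_Bijection" "HOL-Library.Countable_Set"
begin

section \<open>Partial recursive functions\<close>

datatype recf =
    Zero
  | Succ
  | Proj nat
  | Comp recf "recf list"
  | PrimRec recf recf
  | Mu recf

text \<open>
  \<open>rec_eval f xs y\<close> says that \<open>f\<close> converges on the arguments \<open>xs\<close> with value \<open>y\<close>.
  Terms carry no arity: a term applied to a list of a length it does not fit is undefined there,
  so for each fixed \<open>k\<close> the terms denote on lists of length \<open>k\<close> exactly the \<open>k\<close>-ary partial
  recursive functions. Recursion and minimization use the first argument.
\<close>

inductive rec_eval :: "recf \<Rightarrow> nat list \<Rightarrow> nat \<Rightarrow> bool" where
  eval_Zero: "rec_eval Zero xs 0"
| eval_Succ: "rec_eval Succ [x] (Suc x)"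
| eval_Proj: "i < length xs \<Longrightarrow> rec_eval (Proj i) xs (xs ! i)"
| eval_Comp: "\<lbrakk>list_all2 (\<lambda>g y. rec_eval g xs y) gs ys; rec_eval f ys z\<rbrakk>
    \<Longrightarrow> rec_eval (Comp f gs) xs z"
| eval_PrimRec_0: "rec_eval f xs y \<Longrightarrow> rec_eval (PrimRec f g) (0 # xs) y"
| eval_PrimRec_Suc: "\<lbrakk>rec_eval (PrimRec f g) (n # xs) r; rec_eval g (n # r # xs) y\<rbrakk>
    \<Longrightarrow> rec_eval (PrimRec f g) (Suc n # xs) y"
| eval_Mu: "\<lbrakk>rec_eval f (n # xs) 0; \<forall>m<n. \<exists>k. rec_eval f (m # xs) (Suc k)\<rbrakk>
    \<Longrightarrow> rec_eval (Mu f) xs n"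

lemma rec_eval_deterministic: "rec_eval f xs y \<Longrightarrow> rec_eval f xs z \<Longrightarrow> y = z"
proof (induction arbitrary: z rule: rec_eval.induct)
  case (eval_Comp xs gs ys f v)
  from eval_Comp.prems obtain ys' where
    1: "list_all2 (\<lambda>g y. rec_eval g xs y) gs ys'" and 2: "rec_eval f ys' z"
    by (cases rule: rec_eval.cases) auto
  have "ys = ys'"
    using eval_Comp.IH(1) 1 by (auto simp: list_all2_conv_all_nth intro: nth_equalityI)
  with eval_Comp.IH(2) 2 show ?case by blast
next
  case (eval_Mu f n xs)
  from eval_Mu.prems have 1: "rec_eval f (z # xs) 0"
    and 2: "\<forall>m<z. \<exists>k. rec_eval f (m # xs) (Suc k)"
    by (cases rule: rec_eval.cases; simp)+
  show ?case
  proof (rule linorder_cases[of n z])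
    assume "n < z"
    then obtain k where "rec_eval f (n # xs) (Suc k)" using 2 by blast
    with eval_Mu.IH(1) have "0 = Suc k" by blast
    then show ?thesis by simp
  next
    assume "z < n"
    with eval_Mu.IH(2) 1 show ?thesis by blast
  qed simp
next
  case (eval_PrimRec_0 f xs y g)
  from eval_PrimRec_0.prems have "rec_eval f xs z" by (cases rule: rec_eval.cases) auto
  with eval_PrimRec_0.IH show ?case by blast
next
  case (eval_PrimRec_Suc f g n xs r y)
  from eval_PrimRec_Suc.prems obtain r' where
    "rec_eval (PrimRec f g) (n # xs) r'" "rec_eval g (n # r' # xs) z"
    by (cases rule: rec_eval.cases) auto
  with eval_PrimRec_Suc.IH show ?case by blast
qed (erule rec_eval.cases; simp)+

definition ce_set :: "nat set \<Rightarrow> bool" where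
  "ce_set A \<longleftrightarrow> (\<exists>f. \<forall>x. x \<in> A \<longleftrightarrow> (\<exists>y. rec_eval f [x] y))"

section \<open>The halting set\<close>

primrec rec_code :: "recf \<Rightarrow> nat" where
  "rec_code Zero = prod_encode (0, 0)"
| "rec_code Succ = prod_encode (1, 0)"
| "rec_code (Proj i) = prod_encode (2, i)"
| "rec_code (Comp f gs) =
    prod_encode (3, prod_encode (rec_code f, list_encode (map rec_code gs)))"
| "rec_code (PrimRec f g) = prod_encode (4, prod_encode (rec_code f, rec_code g))"
| "rec_code (Mu f) = prod_encode (5, rec_code f)"

lemma rec_code_inject: "rec_code f = rec_code g \<Longrightarrow> f = g"
proof (induction f arbitrary: g)
  case (Comp f fs)
  from Comp.prems obtain g' gs where g: "g = Comp g' gs"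
    and eq: "rec_code f = rec_code g'" "map rec_code fs = map rec_code gs"
    by (cases g) (auto simp: list_encode_eq)
  have "fs = gs" using eq(2) Comp.IH(2) by (auto intro: list.inj_map_strong[rotated])
  with g eq(1) Comp.IH(1) show ?case by blast
next
  case Zero then show ?case by (cases g) auto
next
  case Succ then show ?case by (cases g) auto
next
  case (Proj i) then show ?case by (cases g) auto
next
  case (PrimRec f1 f2) then show ?case by (cases g) auto
next
  case (Mu f) then show ?case by (cases g) auto
qed

text \<open>
  This is \<open>{e. \<phi>\<^sub>e(e) converges}\<close>, where \<open>\<phi>\<^sub>e\<close> is the unary partial function of the term with
  code \<open>e\<close>, and the empty function if \<open>e\<close> is not a code.
\<close>

definition halting_set :: "nat set" where
  "halting_set = {e. \<exists>f y. rec_code f = e \<and> rec_eval f [e] y}"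

section \<open>Arithmetical sets\<close>

definition computable_rel :: "nat \<Rightarrow> (nat list \<Rightarrow> bool) \<Rightarrow> bool" where
  "computable_rel k P \<longleftrightarrow>
    (\<exists>f. \<forall>xs. length xs = k \<longrightarrow> rec_eval f xs (if P xs then 1 else 0))"

text \<open>
  \<open>Sigma_rel n k P\<close>: the \<open>k\<close>-ary relation \<open>P\<close> is \<open>\<Sigma>\<^sub>n\<close>. In the successor step \<open>\<not> Q\<close> is
  \<open>\<Pi>\<^sub>n\<close>, and \<open>P\<close> is its projection.
\<close>

primrec Sigma_rel :: "nat \<Rightarrow> nat \<Rightarrow> (nat list \<Rightarrow> bool) \<Rightarrow> bool" where
  "Sigma_rel 0 k P = computable_rel k P"
| "Sigma_rel (Suc n) k P =
    (\<exists>Q. Sigma_rel n (Suc k) Q \<and> (\<forall>xs. length xs = k \<longrightarrow> P xs = (\<exists>y. \<not> Q (y # xs))))"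

definition arithmetical :: "nat set \<Rightarrow> bool" where
  "arithmetical A \<longleftrightarrow> (\<exists>n. Sigma_rel n 1 (\<lambda>xs. xs ! 0 \<in> A))"

section \<open>Enumeration reducibility\<close>

text \<open>\<^const>\<open>set_decode\<close> maps a canonical index \<open>u\<close> to the finite set \<open>D\<^sub>u\<close>.\<close>

definition enumeration_operator :: "(nat set \<Rightarrow> nat set) \<Rightarrow> bool" where
  "enumeration_operator \<Phi> \<longleftrightarrow>
    (\<exists>W. ce_set W \<and>
      (\<forall>A. \<Phi> A = {x. \<exists>u. prod_encode (x, u) \<in> W \<and> set_decode u \<subseteq> A}))"

definition e_le :: "nat set \<Rightarrow> nat set \<Rightarrow> bool"  (infix \<open>\<le>\<^sub>e\<close> 50) where
  "A \<le>\<^sub>e B \<longleftrightarrow> (\<exists>\<Phi>. enumeration_operator \<Phi> \<and> A = \<Phi> B)"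

definition e_less :: "nat set \<Rightarrow> nat set \<Rightarrow> bool"  (infix \<open><\<^sub>e\<close> 50) where
  "A <\<^sub>e B \<longleftrightarrow> A \<le>\<^sub>e B \<and> \<not> B \<le>\<^sub>e A"

definition set_join :: "nat set \<Rightarrow> nat set \<Rightarrow> nat set"  (infixl \<open>\<oplus>\<close> 65) where
  "A \<oplus> B = {2 * x |x. x \<in> A} \<union> {2 * x + 1 |x. x \<in> B}"

definition splitting_class :: "nat set set \<Rightarrow> bool" where
  "splitting_class \<A> \<longleftrightarrow>
    \<A> \<noteq> {} \<and> countable \<A> \<and> (\<forall>B\<in>\<A>. \<forall>A. A \<le>\<^sub>e B \<longrightarrow> A \<in> \<A>) \<and>
    (\<forall>A\<in>\<A>. \<forall>\<B>. finite \<B> \<and> \<B> \<subseteq> {B\<in>\<A>. \<not> B \<le>\<^sub>e A} \<longrightarrow>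
      (\<exists>C\<in>\<A>. A <\<^sub>e C \<and> (\<forall>B\<in>\<B>. B \<oplus> C \<notin> \<A>)))"

end

theory Submission
  imports Defs
begin

text \<open>
  The witness for the failure is the pair \<open>A = {}\<close>, \<open>\<B> = {L, - L}\<close>, where \<open>L\<close> is an arithmetical set
  such that \<open>(L, - L)\<close> is a nontrivial Kalimullin pair: some decidable relation \<open>R\<close> holds on
  \<open>L \<times> - L\<close> and fails on \<open>- L \<times> L\<close>, and neither \<open>L\<close> nor \<open>- L\<close> is c.e.

  Kalimullin pairs have the meet property: a set below both \<open>L \<oplus> C\<close> and \<open>- L \<oplus> C\<close> is below \<open>C\<close>
  (\<open>K_pair_meet\<close>). So if both joins were above \<open>- halting_set\<close>, then so would be \<open>C\<close>. Since joins of
  arithmetical sets are arithmetical, every \<open>C\<close> in the class has a join with \<open>L\<close> or with \<open>- L\<close> in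
  the class, which is what a splitting class forbids, provided \<open>L\<close> and \<open>- L\<close> are in the class
  themselves and not below \<open>{}\<close>. The latter means that they are not c.e. For the former,
  \<open>K_pair_not_above\<close> shows that a co-c.e. set below one half of a Kalimullin pair is c.e. unless the other
  half is; and \<open>- halting_set\<close> is co-c.e. but not c.e.

  For \<open>L\<close> serves the lower cut of a set \<open>X\<close> in the lexicographic order on sets of numbers: if
  \<open>D \<le> X < E\<close> then \<open>D < E\<close>, so the (decidable) order itself separates the cut from its complement. The
  cut determines \<open>X\<close> in a uniform way (\<open>last_bit_lower_cut\<close>), so an arithmetical diagonal
  definition of \<open>X\<close> against all c.e. sets and all their complements makes the cut neither c.e. nor
  co-c.e. (\<open>not_ce_lower_cut_diagonal\<close>).

  Both the definition of \<open>X\<close> and the enumeration of the halting set need a universal c.e. relation.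
  It comes from certificates: an evaluation is witnessed by a finite set of triples (term, arguments,
  value), each of which follows by one evaluation rule from other triples of the set. Whether a number
  codes such a set is decidable, so convergence is \<open>\<Sigma>\<^sub>1\<close> (\<open>converges_rec_code\<close>).
\<close>

section \<open>A calculus of total recursive functions and decidable predicates\<close>

definition computable_fun :: "nat \<Rightarrow> (nat list \<Rightarrow> nat) \<Rightarrow> bool" where
  "computable_fun k g \<longleftrightarrow> (\<exists>f. \<forall>xs. length xs = k \<longrightarrow> rec_eval f xs (g xs))"

lemma computable_fun_cong:
  assumes "computable_fun k g" "\<And>xs. length xs = k \<Longrightarrow> g xs = h xs"
  shows "computable_fun k h"
  using assms unfolding computable_fun_def by metis

lemma computable_fun_nth: "i < k \<Longrightarrow> computable_fun k (\<lambda>xs. xs ! i)"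
  unfolding computable_fun_def by (metis eval_Proj)

lemma computable_fun_comp:
  assumes "computable_fun m h" "length gs = m" "\<And>g. g \<in> set gs \<Longrightarrow> computable_fun k g"
  shows "computable_fun k (\<lambda>xs. h (map (\<lambda>g. g xs) gs))"
proof -
  obtain fh where fh: "\<And>xs. length xs = m \<Longrightarrow> rec_eval fh xs (h xs)"
    using assms(1) unfolding computable_fun_def by blast
  have "\<forall>g\<in>set gs. \<exists>f. \<forall>xs. length xs = k \<longrightarrow> rec_eval f xs (g xs)"
    using assms(3) unfolding computable_fun_def by blast
  then obtain F where F: "\<forall>g\<in>set gs. \<forall>xs. length xs = k \<longrightarrow> rec_eval (F g) xs (g xs)"
    by metis
  have "rec_eval (Comp fh (map F gs)) xs (h (map (\<lambda>g. g xs) gs))" if "length xs = k" for xs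
  proof (rule eval_Comp)
    show "list_all2 (\<lambda>g y. rec_eval g xs y) (map F gs) (map (\<lambda>g. g xs) gs)"
      using F that by (auto simp: list_all2_conv_all_nth)
  qed (use fh assms(2) in auto)
  then show ?thesis unfolding computable_fun_def by blast
qed

lemma computable_fun_const: "computable_fun k (\<lambda>_. c)"
proof (induction c)
  case 0 show ?case unfolding computable_fun_def using eval_Zero by blast
next
  case (Suc c)
  have "computable_fun 1 (\<lambda>xs. Suc (xs ! 0))"
    unfolding computable_fun_def
    by (rule exI[of _ Succ]) (auto simp: length_Suc_conv intro: eval_Succ)
  from computable_fun_comp[OF this, of "[\<lambda>_. c]"] Suc show ?case by simp
qed

lemma computable_fun_primrec:
  assumes "computable_fun k b" "computable_fun (Suc (Suc k)) s"
  shows "computable_fun (Suc k)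
    (\<lambda>xs. rec_nat (b (tl xs)) (\<lambda>n r. s (n # r # tl xs)) (hd xs))"
proof -
  obtain fb fs where f: "\<And>xs. length xs = k \<Longrightarrow> rec_eval fb xs (b xs)"
    "\<And>xs. length xs = Suc (Suc k) \<Longrightarrow> rec_eval fs xs (s xs)"
    using assms unfolding computable_fun_def by blast
  have "rec_eval (PrimRec fb fs) (n # xs) (rec_nat (b xs) (\<lambda>n r. s (n # r # xs)) n)"
    if "length xs = k" for n xs
    by (induction n) (use f that in \<open>auto intro: eval_PrimRec_0 eval_PrimRec_Suc\<close>)
  then show ?thesis
    unfolding computable_fun_def by (intro exI[of _ "PrimRec fb fs"]) (auto simp: length_Suc_conv)
qed

lemma computable_fun_least:
  assumes "computable_fun (Suc k) p" "\<And>xs. length xs = k \<Longrightarrow> \<exists>n. p (n # xs) = 0"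
  shows "computable_fun k (\<lambda>xs. LEAST n. p (n # xs) = 0)"
proof -
  obtain f where f: "\<And>xs. length xs = Suc k \<Longrightarrow> rec_eval f xs (p xs)"
    using assms unfolding computable_fun_def by blast
  have "rec_eval (Mu f) xs (LEAST n. p (n # xs) = 0)" if l: "length xs = k" for xs
  proof (rule eval_Mu)
    have "p ((LEAST n. p (n # xs) = 0) # xs) = 0"
      using assms(2)[OF l] by (rule LeastI_ex)
    then show "rec_eval f ((LEAST n. p (n # xs) = 0) # xs) 0" using f l by (metis length_Cons)
    show "\<forall>m<LEAST n. p (n # xs) = 0. \<exists>k. rec_eval f (m # xs) (Suc k)"
    proof (intro allI impI)
      fix m assume "m < (LEAST n. p (n # xs) = 0)"
      then have "p (m # xs) \<noteq> 0" using not_less_Least by blast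
      then show "\<exists>k. rec_eval f (m # xs) (Suc k)" using f l by (metis length_Cons not0_implies_Suc)
    qed
  qed
  then show ?thesis unfolding computable_fun_def by blast
qed

text \<open>From here on functions are unary, and several variables are packed into one number with
  \<^const>\<open>prod_encode\<close>. Contexts then need no arities: a variable is a composition of projections, and
  closure properties are introduction rules that can be applied by unification.\<close>

definition recursive :: "(nat \<Rightarrow> nat) \<Rightarrow> bool" where
  "recursive g \<longleftrightarrow> computable_fun 1 (\<lambda>xs. g (xs ! 0))"

definition recursive2 :: "(nat \<Rightarrow> nat \<Rightarrow> nat) \<Rightarrow> bool" where
  "recursive2 h \<longleftrightarrow> computable_fun 2 (\<lambda>xs. h (xs ! 0) (xs ! 1))"

definition decidable :: "(nat \<Rightarrow> bool) \<Rightarrow> bool" where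
  "decidable P \<longleftrightarrow> recursive (\<lambda>x. if P x then 1 else 0)"

abbreviation pair :: "nat \<Rightarrow> nat \<Rightarrow> nat" where "pair x y \<equiv> prod_encode (x, y)"
abbreviation pfst :: "nat \<Rightarrow> nat" where "pfst z \<equiv> fst (prod_decode z)"
abbreviation psnd :: "nat \<Rightarrow> nat" where "psnd z \<equiv> snd (prod_decode z)"

lemma computable_fun_recursive:
  assumes "recursive h" "computable_fun k f" shows "computable_fun k (\<lambda>x. h (f x))"
  using computable_fun_comp[of 1 "\<lambda>xs. h (xs ! 0)" "[f]" k] assms by (simp add: recursive_def)

lemma computable_fun_recursive2:
  assumes "recursive2 h" "computable_fun k f" "computable_fun k g"
  shows "computable_fun k (\<lambda>x. h (f x) (g x))"
  using computable_fun_comp[of 2 "\<lambda>xs. h (xs ! 0) (xs ! 1)" "[f, g]" k] assms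
  by (auto simp: recursive2_def)

lemma recursive_comp: "recursive h \<Longrightarrow> recursive f \<Longrightarrow> recursive (\<lambda>x. h (f x))"
  using computable_fun_recursive[of h 1 "\<lambda>xs. f (xs ! 0)"] by (simp add: recursive_def)

lemma recursive_comp2:
  "recursive2 h \<Longrightarrow> recursive f \<Longrightarrow> recursive g \<Longrightarrow> recursive (\<lambda>x. h (f x) (g x))"
  using computable_fun_recursive2[of h 1 "\<lambda>xs. f (xs ! 0)" "\<lambda>xs. g (xs ! 0)"]
  by (simp add: recursive_def)

lemma recursive2_rec_nat:
  assumes "computable_fun 1 b" "computable_fun 3 s"
  shows "recursive2 (\<lambda>n x. rec_nat (b [x]) (\<lambda>n r. s [n, r, x]) n)"
  unfolding recursive2_def
  by (rule computable_fun_cong[of 2, OF computable_fun_primrec[of 1 b s, unfolded Suc_1]])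
    (use assms in \<open>auto simp: numeral_2_eq_2 numeral_3_eq_3 length_Suc_conv\<close>)

lemma recursive_id: "recursive (\<lambda>x. x)"
  unfolding recursive_def by (rule computable_fun_nth) simp

lemma recursive_const: "recursive (\<lambda>_. c)"
  unfolding recursive_def by (rule computable_fun_const)

lemma recursive_Suc: "recursive f \<Longrightarrow> recursive (\<lambda>x. Suc (f x))"
proof (erule recursive_comp[rotated])
  show "recursive Suc" unfolding recursive_def computable_fun_def
    by (rule exI[of _ Succ]) (auto simp: length_Suc_conv intro: eval_Succ)
qed

lemma recursive_Suc_fun: "recursive Suc"
  using recursive_Suc[OF recursive_id] .

lemma recursive2_add: "recursive2 (+)"
proof -
  have "recursive2 (\<lambda>n x. rec_nat ([x] ! 0) (\<lambda>n r. Suc ([n, r, x] ! 1)) n)"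
    by (intro recursive2_rec_nat computable_fun_nth computable_fun_recursive[OF recursive_Suc_fun]) auto
  moreover have "rec_nat x (\<lambda>n r. Suc r) n = n + x" for x n by (induction n) auto
  ultimately show ?thesis by (simp add: recursive2_def)
qed

lemmas recursive_add = recursive_comp2[OF recursive2_add]

lemma recursive_pred: "recursive (\<lambda>x. x - 1)"
proof -
  have "recursive2 (\<lambda>n x. rec_nat ((\<lambda>_. 0) [x]) (\<lambda>n r. [n, r, x] ! 0) n)"
    by (intro recursive2_rec_nat computable_fun_nth computable_fun_const) auto
  moreover have "rec_nat 0 (\<lambda>n r. n) n = n - 1" for n by (cases n) auto
  ultimately have "recursive2 (\<lambda>n x. n - 1)" by (simp add: recursive2_def)
  from recursive_comp2[OF this recursive_id recursive_id] show ?thesis .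
qed

lemma recursive2_diff: "recursive2 (\<lambda>n x. x - n)"
proof -
  have "recursive2 (\<lambda>n x. rec_nat ([x] ! 0) (\<lambda>n r. [n, r, x] ! 1 - 1) n)"
    by (intro recursive2_rec_nat computable_fun_nth computable_fun_recursive[OF recursive_pred]) auto
  moreover have "rec_nat x (\<lambda>n r. r - 1) n = x - n" for x n :: nat by (induction n) auto
  ultimately show ?thesis by (simp add: recursive2_def)
qed

lemma recursive_diff: "recursive f \<Longrightarrow> recursive g \<Longrightarrow> recursive (\<lambda>x. f x - g x)"
  by (rule recursive_comp2[OF recursive2_diff])

lemma recursive2_mult: "recursive2 (*)"
proof -
  have "recursive2 (\<lambda>n x. rec_nat ((\<lambda>_. 0) [x]) (\<lambda>n r. [n, r, x] ! 1 + [n, r, x] ! 2) n)"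
    by (intro recursive2_rec_nat computable_fun_nth computable_fun_const
        computable_fun_recursive2[OF recursive2_add]) auto
  moreover have "rec_nat 0 (\<lambda>n r. r + x) n = n * x" for x n :: nat by (induction n) auto
  ultimately show ?thesis by (simp add: recursive2_def)
qed

lemmas recursive_mult = recursive_comp2[OF recursive2_mult]

lemma recursive_triangle: "recursive (\<lambda>x. triangle x)"
proof -
  have "recursive2 (\<lambda>n x. rec_nat ((\<lambda>_. 0) [x]) (\<lambda>n r. [n, r, x] ! 1 + Suc ([n, r, x] ! 0)) n)"
    by (intro recursive2_rec_nat computable_fun_nth computable_fun_const
        computable_fun_recursive[OF recursive_Suc_fun] computable_fun_recursive2[OF recursive2_add]) auto
  moreover have "rec_nat 0 (\<lambda>n r. r + Suc n) n = triangle n" for n :: nat by (induction n) auto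
  ultimately have "recursive2 (\<lambda>n x. triangle n)" by (simp add: recursive2_def)
  from recursive_comp2[OF this recursive_id recursive_id] show ?thesis .
qed

lemma recursive_prod_encode:
  "recursive f \<Longrightarrow> recursive g \<Longrightarrow> recursive (\<lambda>x. prod_encode (f x, g x))"
  unfolding prod_encode_def case_prod_conv
  by (intro recursive_add recursive_comp[OF recursive_triangle])

lemma triangle_psum: "triangle (pfst z + psnd z) + pfst z = z"
  using prod_decode_inverse[of z] unfolding prod_encode_def by (simp add: case_prod_beta)

text \<open>
  \<^const>\<open>prod_encode\<close> counts along diagonals, and the diagonal of \<open>z\<close> is found by one minimization,
  as the first one whose successor starts after \<open>z\<close>; the two components follow by subtraction.\<close>

lemma psum_eq_Least: "pfst z + psnd z = (LEAST t. Suc z - triangle (Suc t) = 0)"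
proof (rule sym, rule Least_equality)
  note z = triangle_psum[of z]
  then show "Suc z - triangle (Suc (pfst z + psnd z)) = 0" unfolding triangle_Suc by linarith
  fix t assume "Suc z - triangle (Suc t) = 0"
  then have "triangle (pfst z + psnd z) < triangle (Suc t)" using z by linarith
  moreover have "mono triangle" by (rule mono_iff_le_Suc[THEN iffD2]) simp
  ultimately show "pfst z + psnd z \<le> t" by (meson leD monoD not_less_eq_eq)
qed

lemma recursive_psum: "recursive (\<lambda>z. pfst z + psnd z)"
proof -
  have "computable_fun 1 (\<lambda>xs. LEAST t. Suc ((t # xs) ! 1) - triangle (Suc ((t # xs) ! 0)) = 0)"
  proof (rule computable_fun_least)
    show "computable_fun (Suc 1) (\<lambda>xs. Suc (xs ! 1) - triangle (Suc (xs ! 0)))"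
      by (intro computable_fun_nth computable_fun_recursive2[OF recursive2_diff]
        computable_fun_recursive[OF recursive_triangle]
        computable_fun_recursive[OF recursive_Suc_fun]) auto
    fix xs
    have "Suc (xs!0) \<le> triangle (Suc (xs ! 0))" by (induction "xs!0") auto
    then show "\<exists>n. Suc ((n # xs) ! 1) - triangle (Suc ((n # xs) ! 0)) = 0"
      by (intro exI[of _ "xs!0"]) simp
  qed
  then show ?thesis unfolding recursive_def psum_eq_Least by simp
qed

lemma recursive_pfst: "recursive (\<lambda>z. pfst z)"
proof -
  have "pfst z = z - triangle (pfst z + psnd z)" for z
    using triangle_psum[of z] by linarith
  moreover have "recursive (\<lambda>z. z - triangle (pfst z + psnd z))"
    by (intro recursive_diff recursive_id recursive_comp[OF recursive_triangle] recursive_psum)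
  ultimately show ?thesis by presburger
qed

lemma recursive_psnd: "recursive (\<lambda>z. psnd z)"
proof -
  have "recursive (\<lambda>z. (pfst z + psnd z) - pfst z)"
    by (intro recursive_diff recursive_psum recursive_pfst)
  then show ?thesis by simp
qed

lemmas recursive_fst = recursive_comp[OF recursive_pfst]
lemmas recursive_snd = recursive_comp[OF recursive_psnd]

lemma recursive2I: "recursive (\<lambda>z. h (pfst z) (psnd z)) \<Longrightarrow> recursive2 h"
proof -
  have "recursive2 prod"
    if "prod = (\<lambda>x y. prod_encode (x, y))" for prod
    unfolding that recursive2_def prod_encode_def case_prod_conv
    by (intro computable_fun_nth computable_fun_recursive[OF recursive_triangle]
      computable_fun_recursive2[OF recursive2_add]) auto
  then have "computable_fun 2 (\<lambda>xs. prod_encode (xs ! 0, xs ! 1))"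
    by (simp add: recursive2_def)
  moreover assume "recursive (\<lambda>z. h (pfst z) (psnd z))"
  ultimately show "recursive2 h"
    unfolding recursive2_def using computable_fun_recursive by fastforce
qed

lemma recursive_rec_nat:
  assumes b: "recursive b"
    and s: "recursive (\<lambda>z. s (pfst z) (pfst (psnd z)) (psnd (psnd z)))"
    and n: "recursive n"
  shows "recursive (\<lambda>x. rec_nat (b x) (\<lambda>m r. s m r x) (n x))"
proof -
  have pr: "recursive2 (\<lambda>x y. prod_encode (x, y))"
    by (rule recursive2I) (simp add: recursive_id)
  have "computable_fun 3 (\<lambda>xs. prod_encode (xs ! 0, prod_encode (xs ! 1, xs ! 2)))"
    by (intro computable_fun_recursive2[OF pr] computable_fun_nth) auto
  from computable_fun_recursive[OF s this]
  have "computable_fun 3 (\<lambda>xs. s (xs ! 0) (xs ! 1) (xs ! 2))" by simp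
  from recursive2_rec_nat[OF _ this, of "\<lambda>xs. b (xs ! 0)"] b
  have "recursive2 (\<lambda>n x. rec_nat (b x) (\<lambda>m r. s m r x) n)" by (simp add: recursive_def)
  from recursive_comp2[OF this n recursive_id] show ?thesis .
qed

lemma recursive_cong:
  assumes "recursive f" "\<And>x. f x = g x" shows "recursive g"
  using assms(1) ext[of f g, OF assms(2)] by simp

lemma decidable_cong:
  assumes "decidable P" "\<And>x. P x \<longleftrightarrow> Q x" shows "decidable Q"
  using assms(1) ext[of P Q, OF assms(2)] by simp

lemma decidable_comp: "decidable P \<Longrightarrow> recursive f \<Longrightarrow> decidable (\<lambda>x. P (f x))"
  unfolding decidable_def by (rule recursive_comp)

lemma recursive_if:
  assumes "decidable P" "recursive f" "recursive g"
  shows "recursive (\<lambda>x. if P x then f x else g x)"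
proof -
  have "recursive (\<lambda>x. (if P x then 1 else 0) * f x + (1 - (if P x then 1 else 0)) * g x)"
    using assms unfolding decidable_def
    by (intro recursive_add recursive_mult recursive_diff recursive_const)
  moreover have "(\<lambda>x. (if P x then 1 else 0) * f x + (1 - (if P x then 1 else 0)) * g x)
    = (\<lambda>x. if P x then f x else g x)" by auto
  ultimately show ?thesis by simp
qed

lemma decidable_const: "decidable (\<lambda>_. b)"
  unfolding decidable_def by (rule recursive_const)

lemma decidable_if:
  assumes "decidable P" "decidable Q" "decidable R"
  shows "decidable (\<lambda>x. if P x then Q x else R x)"
proof -
  have "recursive (\<lambda>x. if P x then (if Q x then 1 else 0) else (if R x then 1 else 0))"
    using assms by (intro recursive_if) (simp_all only: decidable_def recursive_const)
  then show ?thesis unfolding decidable_def by (rule recursive_cong) auto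
qed

lemma decidable_not: "decidable P \<Longrightarrow> decidable (\<lambda>x. \<not> P x)"
  by (rule decidable_cong[OF decidable_if[of P "\<lambda>_. False" "\<lambda>_. True"]])
    (auto intro: decidable_const)

lemma decidable_conj: "decidable P \<Longrightarrow> decidable Q \<Longrightarrow> decidable (\<lambda>x. P x \<and> Q x)"
  by (rule decidable_cong[OF decidable_if[of P Q "\<lambda>_. False"]]) (auto intro: decidable_const)

lemma decidable_disj: "decidable P \<Longrightarrow> decidable Q \<Longrightarrow> decidable (\<lambda>x. P x \<or> Q x)"
  by (rule decidable_cong[OF decidable_if[of P "\<lambda>_. True" Q]]) (auto intro: decidable_const)

lemma decidable_imp: "decidable P \<Longrightarrow> decidable Q \<Longrightarrow> decidable (\<lambda>x. P x \<longrightarrow> Q x)"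
  by (rule decidable_cong[OF decidable_if[of P Q "\<lambda>_. True"]]) (auto intro: decidable_const)

lemma decidable_iff: "decidable P \<Longrightarrow> decidable Q \<Longrightarrow> decidable (\<lambda>x. P x \<longleftrightarrow> Q x)"
  by (rule decidable_cong[OF decidable_if[of P Q "\<lambda>x. \<not> Q x"]]) (auto intro: decidable_not)

lemma decidable_zero: "recursive f \<Longrightarrow> decidable (\<lambda>x. f x = 0)"
proof -
  assume "recursive f"
  then have "recursive (\<lambda>x. 1 - f x)" by (intro recursive_diff recursive_const)
  then show ?thesis unfolding decidable_def by (rule recursive_cong) auto
qed

lemma decidable_le: "recursive f \<Longrightarrow> recursive g \<Longrightarrow> decidable (\<lambda>x. f x \<le> g x)"
  using decidable_zero[OF recursive_diff, of f g] by simp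

lemma decidable_less: "recursive f \<Longrightarrow> recursive g \<Longrightarrow> decidable (\<lambda>x. f x < g x)"
  using decidable_le[OF recursive_Suc, of f g] by (simp add: Suc_le_eq)

lemma decidable_eq: "recursive f \<Longrightarrow> recursive g \<Longrightarrow> decidable (\<lambda>x. f x = g x)"
  using decidable_conj[OF decidable_le decidable_le, of f g g f] by (simp add: eq_iff)

text \<open>Recursion on the bound, carrying along whether a witness has been found.\<close>

lemma decidable_ex_less:
  assumes "decidable (\<lambda>z. P (pfst z) (psnd z))" "recursive b"
  shows "decidable (\<lambda>x. \<exists>n<b x. P n x)"
proof -
  have "recursive (\<lambda>x. rec_nat 0 (\<lambda>m r. if P m x then 1 else r) (b x))"
  proof (rule recursive_rec_nat[OF recursive_const _ assms(2)], rule recursive_if)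
    show "decidable (\<lambda>z. P (pfst z) (psnd (psnd z)))"
      using decidable_comp[OF assms(1), of "\<lambda>z. prod_encode (pfst z, psnd (psnd z))"]
      by (simp add: recursive_prod_encode recursive_pfst recursive_snd recursive_psnd)
  qed (intro recursive_const recursive_fst recursive_psnd)+
  moreover have "rec_nat 0 (\<lambda>m r. if P m x then 1 else r) k = (if \<exists>n<k. P n x then 1 else 0)"
    for k x by (induction k) (auto simp: less_Suc_eq)
  ultimately show ?thesis unfolding decidable_def by (rule recursive_cong)
qed

lemma decidable_all_less:
  assumes "decidable (\<lambda>z. P (pfst z) (psnd z))" "recursive b"
  shows "decidable (\<lambda>x. \<forall>n<b x. P n x)"
  using decidable_not[OF decidable_ex_less[OF decidable_not[OF assms(1)] assms(2)]] by simp

lemma recursive_Least: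
  assumes "decidable (\<lambda>z. P (pfst z) (psnd z))" "\<And>x. \<exists>n. P n x"
  shows "recursive (\<lambda>x. LEAST n. P n x)"
proof -
  have "recursive2 (\<lambda>n x. if P n x then 0 else 1)"
    by (intro recursive2I recursive_if assms(1) recursive_const)
  then have "computable_fun 1 (\<lambda>xs. LEAST n. (if P ((n # xs) ! 0) ((n # xs) ! 1) then 0 else 1) = (0::nat))"
    by (intro computable_fun_least) (auto simp: recursive2_def numeral_2_eq_2 assms(2))
  moreover have "((if P n x then 0 else 1) = (0::nat)) = P n x" for n x by simp
  ultimately show ?thesis unfolding recursive_def by simp
qed

text \<open>Under a bounded quantifier the new variable becomes \<open>pfst z\<close> and the old context \<open>psnd z\<close>.\<close>

lemmas recursive_intros = recursive_id recursive_const recursive_Suc recursive_add recursive_diff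
  recursive_mult recursive_prod_encode recursive_fst recursive_snd recursive_if
  decidable_const decidable_not decidable_conj decidable_disj decidable_imp decidable_iff
  decidable_le decidable_less decidable_eq decidable_ex_less decidable_all_less

section \<open>Finite sets and lists as numbers\<close>

lemma recursive_div2: "recursive f \<Longrightarrow> recursive (\<lambda>x. f x div 2)"
proof (erule recursive_comp[rotated])
  have "recursive (\<lambda>x. LEAST q. x < 2 * Suc q)"
  proof (rule recursive_Least)
    show "\<exists>q. x < 2 * Suc q" for x by (rule exI[of _ x]) simp
  qed (intro recursive_intros)
  moreover have "(LEAST q. x < 2 * Suc q) = x div 2" for x by (rule Least_equality) auto
  ultimately show "recursive (\<lambda>x. x div 2)" by simp
qed

lemma decidable_even: "recursive f \<Longrightarrow> decidable (\<lambda>x. even (f x))"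
proof -
  assume "recursive f"
  then have "decidable (\<lambda>x. f x = 2 * (f x div 2))" by (intro recursive_intros recursive_div2)
  then show ?thesis by (rule decidable_cong) presburger
qed

text \<open>Halving \<open>u\<close> as often as \<open>n\<close> says moves its binary digit \<open>n\<close> to the front.\<close>

lemma decidable_mem_set_decode:
  assumes "recursive f" "recursive g" shows "decidable (\<lambda>x. f x \<in> set_decode (g x))"
proof -
  have "recursive (\<lambda>x. rec_nat (g x) (\<lambda>_ r. r div 2) (f x))"
    using assms by (intro recursive_rec_nat recursive_intros recursive_div2)
  then have "decidable (\<lambda>x. \<not> even (rec_nat (g x) (\<lambda>_ r. r div 2) (f x)))"
    by (intro decidable_not decidable_even)
  moreover have "n \<in> set_decode u \<longleftrightarrow> odd (rec_nat u (\<lambda>_ r. r div 2) n)" for n u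
  proof -
    have "rec_nat (u div 2) (\<lambda>_ r. r div 2) m = rec_nat u (\<lambda>_ r. r div 2) m div 2" for m u :: nat
      by (induction m) auto
    then show ?thesis by (induction n arbitrary: u) simp_all
  qed
  ultimately show ?thesis by simp
qed

lemma mem_set_decode_less: "n \<in> set_decode u \<Longrightarrow> n < u"
proof -
  assume "n \<in> set_decode u"
  then have "u div 2 ^ n \<noteq> 0" unfolding set_decode_def by (metis even_zero mem_Collect_eq)
  then have "2 ^ n \<le> u" by (metis div_less not_less)
  then show ?thesis using less_exp[of n] by linarith
qed

lemma decidable_ball_set_decode:
  assumes "decidable (\<lambda>z. P (pfst z) (psnd z))" "recursive u"
  shows "decidable (\<lambda>x. \<forall>d\<in>set_decode (u x). P d x)"
proof -
  have "decidable (\<lambda>x. \<forall>d<u x. d \<in> set_decode (u x) \<longrightarrow> P d x)"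
    by (intro recursive_intros decidable_mem_set_decode recursive_comp[OF assms(2)] assms)
  then show ?thesis by (rule decidable_cong) (auto dest: mem_set_decode_less)
qed

text \<open>These are the list operations on codes under \<^const>\<open>list_encode\<close>. The code \<open>0\<close> of the empty list is a
  fixed point of dropping an element, because \<open>prod_decode 0 = (0, 0)\<close>; so every list is exhausted
  at some finite stage, and the least such stage is its length.\<close>

definition code_cons :: "nat \<Rightarrow> nat \<Rightarrow> nat" where "code_cons x l = Suc (pair x l)"
definition code_hd :: "nat \<Rightarrow> nat" where "code_hd l = pfst (l - 1)"
definition code_drop :: "nat \<Rightarrow> nat \<Rightarrow> nat" where
  "code_drop n l = rec_nat l (\<lambda>_ r. psnd (r - 1)) n"
definition code_nth :: "nat \<Rightarrow> nat \<Rightarrow> nat" where "code_nth l n = code_hd (code_drop n l)"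
definition code_length :: "nat \<Rightarrow> nat" where "code_length l = (LEAST n. code_drop n l = 0)"

lemma code_drop_list_encode: "code_drop n (list_encode xs) = list_encode (drop n xs)"
proof (induction n)
  case (Suc n)
  have "prod_decode 0 = (0, 0)"
    using prod_encode_inverse[of "(0, 0)"] by (simp add: prod_encode_def)
  then have "psnd (list_encode ys - 1) = list_encode (tl ys)" for ys by (cases ys) auto
  with Suc show ?case by (simp add: code_drop_def drop_Suc tl_drop)
qed (simp add: code_drop_def)

lemma list_encode_eq_0 [simp]: "list_encode xs = 0 \<longleftrightarrow> xs = []"
  by (cases xs) auto

lemma code_length_list_encode [simp]: "code_length (list_encode xs) = length xs"
  unfolding code_length_def code_drop_list_encode by (rule Least_equality) auto

lemma code_cons_list_encode [simp]: "code_cons x (list_encode xs) = list_encode (x # xs)"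
  by (simp add: code_cons_def)

lemma code_hd_list_encode [simp]: "code_hd (list_encode (x # xs)) = x"
  by (simp add: code_hd_def)

lemma code_drop_Suc0_list_encode [simp]: "code_drop (Suc 0) (list_encode (x # xs)) = list_encode xs"
  using code_drop_list_encode[of "Suc 0" "x # xs"] by simp

lemma code_nth_list_encode [simp]: "n < length xs \<Longrightarrow> code_nth (list_encode xs) n = xs ! n"
  unfolding code_nth_def code_drop_list_encode by (metis Cons_nth_drop_Suc code_hd_list_encode)

lemma recursive_code_cons: "recursive f \<Longrightarrow> recursive g \<Longrightarrow> recursive (\<lambda>x. code_cons (f x) (g x))"
  unfolding code_cons_def by (intro recursive_intros)

lemma recursive_code_hd: "recursive f \<Longrightarrow> recursive (\<lambda>x. code_hd (f x))"
  unfolding code_hd_def by (intro recursive_intros)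

lemma recursive_code_drop:
  "recursive f \<Longrightarrow> recursive g \<Longrightarrow> recursive (\<lambda>x. code_drop (f x) (g x))"
  unfolding code_drop_def by (intro recursive_intros recursive_rec_nat)

lemma recursive_code_nth:
  "recursive f \<Longrightarrow> recursive g \<Longrightarrow> recursive (\<lambda>x. code_nth (f x) (g x))"
  unfolding code_nth_def by (intro recursive_code_hd recursive_code_drop)

lemma recursive_code_length: "recursive f \<Longrightarrow> recursive (\<lambda>x. code_length (f x))"
proof (erule recursive_comp[rotated])
  have "\<exists>n. code_drop n l = 0" for l
    using code_drop_list_encode[of "length (list_decode l)" "list_decode l"] by auto
  then show "recursive (\<lambda>x. code_length x)" unfolding code_length_def
    by (intro recursive_Least recursive_intros recursive_code_drop)
qed

lemmas code_intros = recursive_intros recursive_div2 decidable_even decidable_mem_set_decode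
  decidable_ball_set_decode recursive_code_cons recursive_code_hd recursive_code_drop
  recursive_code_nth recursive_code_length

section \<open>Computation certificates\<close>

abbreviation triple :: "nat \<Rightarrow> nat \<Rightarrow> nat \<Rightarrow> nat" where
  "triple c l y \<equiv> pair c (pair l y)"

text \<open>One clause for each evaluation rule, on codes: \<open>c\<close> codes the term, \<open>l\<close> the argument list, \<open>y\<close> is the
  value, and the premises of the rule are looked up in \<open>S\<close>. The numbers 0 to 5 are the
  constructor tags of \<^const>\<open>rec_code\<close>. The equations \<open>l = code_cons (code_hd l) _\<close> fix the shape of
  the argument list; in the clause for primitive recursion this says that it is not empty.\<close>

definition step_justified :: "nat set \<Rightarrow> nat \<Rightarrow> nat \<Rightarrow> nat \<Rightarrow> bool" where
  "step_justified S c l y \<longleftrightarrow>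
    pfst c = 0 \<and> y = 0 \<or>
    pfst c = 1 \<and> l = code_cons (code_hd l) 0 \<and> y = Suc (code_hd l) \<or>
    pfst c = 2 \<and> psnd c < code_length l \<and> y = code_nth l (psnd c) \<or>
    pfst c = 3 \<and> (\<exists>m. triple (pfst (psnd c)) m y \<in> S \<and>
      code_length m = code_length (psnd (psnd c)) \<and>
      (\<forall>i<code_length m. triple (code_nth (psnd (psnd c)) i) l (code_nth m i) \<in> S)) \<or>
    pfst c = 4 \<and> l = code_cons (code_hd l) (code_drop 1 l) \<and>
      (code_hd l = 0 \<and> triple (pfst (psnd c)) (code_drop 1 l) y \<in> S \<or>
       code_hd l \<noteq> 0 \<and> (\<exists>r. triple c (code_cons (code_hd l - 1) (code_drop 1 l)) r \<in> S \<and>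
        triple (psnd (psnd c)) (code_cons (code_hd l - 1) (code_cons r (code_drop 1 l))) y \<in> S)) \<or>
    pfst c = 5 \<and> triple (psnd c) (code_cons y l) 0 \<in> S \<and>
      (\<forall>m<y. \<exists>k. triple (psnd c) (code_cons m l) (Suc k) \<in> S)"

text \<open>The triples need no order: each premise of an evaluation rule is about a proper subterm, or about the
  same primitive recursion with a smaller first argument, so justifications cannot be circular.\<close>

definition certificate :: "nat set \<Rightarrow> bool" where
  "certificate S \<longleftrightarrow> (\<forall>t\<in>S. step_justified S (pfst t) (pfst (psnd t)) (psnd (psnd t)))"

lemma step_justified_mono: "S \<subseteq> T \<Longrightarrow> step_justified S c l y \<Longrightarrow> step_justified T c l y"
  unfolding step_justified_def by (elim disjE) (simp_all, blast+)

lemma certificate_Union: "(\<And>S. S \<in> \<S> \<Longrightarrow> certificate S) \<Longrightarrow> certificate (\<Union>\<S>)"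
  unfolding certificate_def by (meson Union_iff Union_upper step_justified_mono)

lemma certificate_insert:
  "certificate S \<Longrightarrow> step_justified S c l y \<Longrightarrow> certificate (insert (triple c l y) S)"
  unfolding certificate_def
  by (auto intro: step_justified_mono[OF subset_insertI])

text \<open>By induction on the term, and within a primitive recursion by induction on its first argument.\<close>

lemma certificate_sound:
  assumes S: "certificate S"
  shows "triple (rec_code f) (list_encode xs) y \<in> S \<Longrightarrow> rec_eval f xs y"
proof (induction f arbitrary: xs y)
  case Zero
  then have "step_justified S (rec_code Zero) (list_encode xs) y"
    using S unfolding certificate_def by fastforce
  then show ?case by (auto simp: step_justified_def intro: eval_Zero)
next
  case Succ
  then have "step_justified S (rec_code Succ) (list_encode xs) y"
    using S unfolding certificate_def by fastforce
  then have "list_encode xs = list_encode [code_hd (list_encode xs)]"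
    "y = Suc (code_hd (list_encode xs))"
    by (auto simp: step_justified_def code_cons_def)
  then show ?case by (metis eval_Succ list_encode_eq)
next
  case (Proj i)
  then have "step_justified S (rec_code (Proj i)) (list_encode xs) y"
    using S unfolding certificate_def by fastforce
  then show ?case by (auto simp: step_justified_def intro: eval_Proj)
next
  case (Comp f gs)
  then have "step_justified S (rec_code (Comp f gs)) (list_encode xs) y"
    using S unfolding certificate_def by fastforce
  then obtain m where m: "triple (rec_code f) m y \<in> S" "code_length m = length gs"
    "\<forall>i<length gs. triple (code_nth (list_encode (map rec_code gs)) i) (list_encode xs) (code_nth m i) \<in> S"
    by (auto simp: step_justified_def)
  obtain ys where ys: "m = list_encode ys" by (metis list_decode_inverse)
  show ?case
  proof (rule eval_Comp)
    show "list_all2 (\<lambda>g y. rec_eval g xs y) gs ys"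
      using m ys Comp.IH(2) by (auto simp: list_all2_conv_all_nth)
    show "rec_eval f ys y" using m(1) ys Comp.IH(1) by blast
  qed
next
  case (PrimRec f g)
  have J: "step_justified S (rec_code (PrimRec f g)) (list_encode xs) y"
    if "triple (rec_code (PrimRec f g)) (list_encode xs) y \<in> S" for xs y
    using S that unfolding certificate_def by fastforce
  have "rec_eval (PrimRec f g) (n # xs) y"
    if "triple (rec_code (PrimRec f g)) (list_encode (n # xs)) y \<in> S" for n xs y
    using that
  proof (induction n arbitrary: y)
    case 0
    from J[OF 0] have "triple (rec_code f) (list_encode xs) y \<in> S"
      by (auto simp: step_justified_def simp del: list_encode.simps)
    with PrimRec.IH(1) show ?case by (intro eval_PrimRec_0)
  next
    case (Suc n)
    from J[OF Suc.prems] obtain r where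
      "triple (rec_code (PrimRec f g)) (list_encode (n # xs)) r \<in> S"
      "triple (rec_code g) (list_encode (n # r # xs)) y \<in> S"
      by (auto simp: step_justified_def simp del: list_encode.simps)
    with Suc.IH PrimRec.IH(2) show ?case by (blast intro: eval_PrimRec_Suc)
  qed
  moreover have "list_encode xs = code_cons (code_hd (list_encode xs)) (code_drop 1 (list_encode xs))"
    using J[OF PrimRec.prems] by (auto simp: step_justified_def)
  then have "xs \<noteq> []" by (auto simp: code_cons_def)
  ultimately show ?case using PrimRec.prems by (metis list.exhaust)
next
  case (Mu f)
  then have "step_justified S (rec_code (Mu f)) (list_encode xs) y"
    using S unfolding certificate_def by fastforce
  then have "triple (rec_code f) (list_encode (y # xs)) 0 \<in> S"
    "\<forall>m<y. \<exists>k. triple (rec_code f) (list_encode (m # xs)) (Suc k) \<in> S"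
    by (auto simp: step_justified_def simp del: list_encode.simps)
  then show ?case by (intro eval_Mu) (blast intro: Mu.IH)+
qed

definition certified :: "recf \<Rightarrow> nat list \<Rightarrow> nat \<Rightarrow> bool" where
  "certified f xs y \<longleftrightarrow>
    (\<exists>S. finite S \<and> certificate S \<and> triple (rec_code f) (list_encode xs) y \<in> S)"

text \<open>Certificates are closed under union, so the finitely many premises of a rule share one.\<close>

lemma certified_common:
  assumes "finite I" "\<And>i. i \<in> I \<Longrightarrow> certified (f i) (xs i) (y i)"
  obtains S where "finite S" "certificate S"
    "\<And>i. i \<in> I \<Longrightarrow> triple (rec_code (f i)) (list_encode (xs i)) (y i) \<in> S"
proof -
  obtain C where C: "\<And>i. i \<in> I \<Longrightarrow> finite (C i) \<and> certificate (C i) \<and>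
    triple (rec_code (f i)) (list_encode (xs i)) (y i) \<in> C i"
    using assms(2) unfolding certified_def by metis
  show thesis
  proof (rule that[of "\<Union>(C ` I)"])
    show "certificate (\<Union>(C ` I))" by (rule certificate_Union) (use C in auto)
  qed (use C assms(1) in auto)
qed

lemma certifiedI:
  assumes "finite S" "certificate S" "step_justified S (rec_code f) (list_encode xs) y"
  shows "certified f xs y"
  unfolding certified_def using certificate_insert[OF assms(2,3)] assms(1)
  by (intro exI[of _ "insert (triple (rec_code f) (list_encode xs) y) S"]) simp

lemma rec_eval_certified: "rec_eval f xs y \<Longrightarrow> certified f xs y"
proof (induction rule: rec_eval.induct)
  case (eval_Zero xs)
  show ?case by (rule certifiedI[of "{}"]) (auto simp: certificate_def step_justified_def)
next
  case (eval_Succ x)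
  show ?case by (rule certifiedI[of "{}"])
    (auto simp: certificate_def step_justified_def code_cons_def simp flip: list_encode.simps)
next
  case (eval_Proj i xs)
  then show ?case by (intro certifiedI[of "{}"]) (auto simp: certificate_def step_justified_def)
next
  case (eval_Comp xs gs ys f z)
  from eval_Comp.IH have len: "length gs = length ys"
    and args: "\<And>i. i < length gs \<Longrightarrow> certified (gs ! i) xs (ys ! i)" and val: "certified f ys z"
    by (auto simp: list_all2_conv_all_nth)
  obtain S where S: "finite S" "certificate S" and
    St: "\<And>i. i \<in> {..length gs} \<Longrightarrow> triple (rec_code (if i < length gs then gs ! i else f))
      (list_encode (if i < length gs then xs else ys)) (if i < length gs then ys ! i else z) \<in> S"
    by (rule certified_common[of "{..length gs}" "\<lambda>i. if i < length gs then gs ! i else f"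
      "\<lambda>i. if i < length gs then xs else ys" "\<lambda>i. if i < length gs then ys ! i else z"])
      (use args val in auto)
  have "triple (rec_code f) (list_encode ys) z \<in> S" using St[of "length gs"] by simp
  moreover have "triple (rec_code (gs ! i)) (list_encode xs) (ys ! i) \<in> S" if "i < length gs" for i
    using St[of i] that by simp
  ultimately have "step_justified S (rec_code (Comp f gs)) (list_encode xs) z"
    unfolding step_justified_def using len by (auto intro!: exI[of _ "list_encode ys"])
  then show ?case using S certifiedI by blast
next
  case (eval_PrimRec_0 f xs y g)
  then obtain S where S: "finite S" "certificate S" "triple (rec_code f) (list_encode xs) y \<in> S"
    unfolding certified_def by blast
  then have "step_justified S (rec_code (PrimRec f g)) (list_encode (0 # xs)) y"
    unfolding step_justified_def by (auto simp del: list_encode.simps)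
  then show ?case using S certifiedI by blast
next
  case (eval_PrimRec_Suc f g n xs r y)
  obtain S where S: "finite S" "certificate S" and
    St: "\<And>b. b \<in> UNIV \<Longrightarrow> triple (rec_code (if b then PrimRec f g else g))
      (list_encode (if b then n # xs else n # r # xs)) (if b then r else y) \<in> S"
    by (rule certified_common[of "UNIV :: bool set" "\<lambda>b. if b then PrimRec f g else g"
      "\<lambda>b. if b then n # xs else n # r # xs" "\<lambda>b. if b then r else y"])
      (use eval_PrimRec_Suc.IH in auto)
  have "triple (rec_code (PrimRec f g)) (list_encode (n # xs)) r \<in> S"
    "triple (rec_code g) (list_encode (n # r # xs)) y \<in> S"
    using St[of True] St[of False] by simp_all
  then have "step_justified S (rec_code (PrimRec f g)) (list_encode (Suc n # xs)) y"
    unfolding step_justified_def by (auto simp del: list_encode.simps)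
  then show ?case using S certifiedI by blast
next
  case (eval_Mu f n xs)
  then obtain k where k: "\<And>m. m < n \<Longrightarrow> certified f (m # xs) (Suc (k m))" by metis
  obtain S where S: "finite S" "certificate S" and
    St: "\<And>m. m \<in> {..n} \<Longrightarrow> triple (rec_code f) (list_encode (m # xs)) (if m < n then Suc (k m) else 0) \<in> S"
    by (rule certified_common[of "{..n}" "\<lambda>_. f" "\<lambda>m. m # xs" "\<lambda>m. if m < n then Suc (k m) else 0"])
      (use k eval_Mu.IH(1) in auto)
  have "triple (rec_code f) (list_encode (n # xs)) 0 \<in> S" using St[of n] by simp
  moreover have "\<forall>m<n. \<exists>k. triple (rec_code f) (list_encode (m # xs)) (Suc k) \<in> S"
  proof (intro allI impI)
    fix m assume "m < n"
    then show "\<exists>k. triple (rec_code f) (list_encode (m # xs)) (Suc k) \<in> S"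
      using St[of m] by (intro exI[of _ "k m"]) simp
  qed
  ultimately have "step_justified S (rec_code (Mu f)) (list_encode xs) n"
    unfolding step_justified_def by (auto simp del: list_encode.simps)
  then show ?case using S certifiedI by blast
qed

lemma triple_less:
  assumes "triple c l y \<in> set_decode u" shows "c < u" "l < u" "y < u"
  using mem_set_decode_less[OF assms] le_prod_encode_1[of c "pair l y"]
    le_prod_encode_2[of "pair l y" c] le_prod_encode_1[of l y] le_prod_encode_2[of y l]
  by linarith+

lemma decidable_ex_bounded:
  assumes "decidable (\<lambda>z. P (pfst z) (psnd z))" "recursive b" "\<And>n x. P n x \<Longrightarrow> n < b x"
  shows "decidable (\<lambda>x. \<exists>n. P n x)"
  by (rule decidable_cong[OF decidable_ex_less[OF assms(1,2)]]) (use assms(3) in blast)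

text \<open>The unbounded quantifiers in \<^const>\<open>step_justified\<close> range over components of elements of the finite
  set with canonical index \<open>u\<close>, and these are smaller than \<open>u\<close>.\<close>

lemma decidable_step_justified:
  assumes "recursive u" "recursive c" "recursive l" "recursive y"
  shows "decidable (\<lambda>x. step_justified (set_decode (u x)) (c x) (l x) (y x))"
proof -
  have 1: "decidable (\<lambda>x. \<exists>m. triple (pfst (psnd (c x))) m (y x) \<in> set_decode (u x) \<and>
      code_length m = code_length (psnd (psnd (c x))) \<and>
      (\<forall>i<code_length m.
        triple (code_nth (psnd (psnd (c x))) i) (l x) (code_nth m i) \<in> set_decode (u x)))"
    by (rule decidable_ex_bounded[where b = u, OF _ assms(1)])
      (intro code_intros assms[THEN recursive_comp] assms, elim conjE, erule triple_less(2))
  have 2: "decidable (\<lambda>x. \<exists>r. triple (c x) (code_cons (code_hd (l x) - 1) (code_drop 1 (l x))) r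
        \<in> set_decode (u x) \<and>
      triple (psnd (psnd (c x))) (code_cons (code_hd (l x) - 1) (code_cons r (code_drop 1 (l x)))) (y x)
        \<in> set_decode (u x))"
    by (rule decidable_ex_bounded[where b = u, OF _ assms(1)])
      (intro code_intros assms[THEN recursive_comp] assms, elim conjE, erule triple_less(3))
  have "decidable (\<lambda>z. \<exists>k. triple (psnd (c (psnd z))) (code_cons (pfst z) (l (psnd z))) (Suc k)
      \<in> set_decode (u (psnd z)))"
    by (rule decidable_ex_bounded[OF _ recursive_comp[OF assms(1) recursive_psnd]])
      (intro code_intros assms[THEN recursive_comp] assms, drule triple_less(3), simp)
  then have 3: "decidable (\<lambda>x. \<forall>m<y x. \<exists>k. triple (psnd (c x)) (code_cons m (l x)) (Suc k)
      \<in> set_decode (u x))"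
    by (intro code_intros assms)
  show ?thesis
    unfolding step_justified_def
    by (intro 1 2 3 decidable_disj decidable_conj; intro code_intros assms)
qed

section \<open>Codes of terms\<close>

text \<open>A certificate for a triple does not show that its first component is the code of a term: the value of
  \<open>PrimRec f g\<close> at first argument \<open>0\<close> is found without looking at \<open>g\<close>. Membership in the set of codes
  therefore gets its own certificates, finite sets closed under taking the codes of immediate
  subterms.\<close>

definition code_justified :: "nat set \<Rightarrow> nat \<Rightarrow> bool" where
  "code_justified V c \<longleftrightarrow>
    pfst c = 0 \<and> psnd c = 0 \<or> pfst c = 1 \<and> psnd c = 0 \<or> pfst c = 2 \<or>
    pfst c = 3 \<and> pfst (psnd c) \<in> V \<and>
      (\<forall>i<code_length (psnd (psnd c)). code_nth (psnd (psnd c)) i \<in> V) \<or>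
    pfst c = 4 \<and> pfst (psnd c) \<in> V \<and> psnd (psnd c) \<in> V \<or>
    pfst c = 5 \<and> psnd c \<in> V"

definition codes_closed :: "nat set \<Rightarrow> bool" where
  "codes_closed V \<longleftrightarrow> (\<forall>c\<in>V. code_justified V c)"

lemma code_justified_mono: "V \<subseteq> W \<Longrightarrow> code_justified V c \<Longrightarrow> code_justified W c"
  unfolding code_justified_def by (elim disjE) (simp_all, blast+)

lemma codes_closed_Union: "(\<And>V. V \<in> \<V> \<Longrightarrow> codes_closed V) \<Longrightarrow> codes_closed (\<Union>\<V>)"
  unfolding codes_closed_def by (meson Union_iff Union_upper code_justified_mono)

lemma codes_closed_insert: "codes_closed V \<Longrightarrow> code_justified V c \<Longrightarrow> codes_closed (insert c V)"
  unfolding codes_closed_def by (auto intro: code_justified_mono[OF subset_insertI])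

lemma less_prod_encode_2: "0 < a \<Longrightarrow> b < prod_encode (a, b)"
proof -
  have "n \<le> triangle n" for n by (induction n) auto
  from this[of "a + b"] show "0 < a \<Longrightarrow> b < prod_encode (a, b)" by (simp add: prod_encode_def)
qed

lemma nth_le_list_encode: "i < length xs \<Longrightarrow> xs ! i \<le> list_encode xs"
proof (induction xs arbitrary: i)
  case (Cons x xs)
  then show ?case
    using le_prod_encode_1[of x "list_encode xs"] le_prod_encode_2[of "list_encode xs" x]
    by (cases i) (auto intro: le_trans le_SucI)
qed simp

text \<open>By strong induction on the number, since the code of a proper subterm is smaller.\<close>

lemma codes_closed_sound:
  assumes V: "codes_closed V"
  shows "c \<in> V \<Longrightarrow> \<exists>f. rec_code f = c"
proof (induction c rule: less_induct)
  case (less c)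
  obtain t a where c: "c = pair t a" by (metis prod_decode_inverse surj_pair)
  have a: "pfst a \<le> a" "psnd a \<le> a"
    using le_prod_encode_1[of "pfst a" "psnd a"] le_prod_encode_2[of "psnd a" "pfst a"] by simp_all
  have sub: "\<exists>f. rec_code f = d" if "0 < t" "d \<le> a" "d \<in> V" for d
    using less.IH that less_prod_encode_2[of t a] c by simp
  consider "t = 0" "a = 0" | "t = 1" "a = 0" | "t = 2"
    | "t = 3" "pfst a \<in> V" "\<forall>i<code_length (psnd a). code_nth (psnd a) i \<in> V"
    | "t = 4" "pfst a \<in> V" "psnd a \<in> V" | "t = 5" "a \<in> V"
    using V less.prems c by (auto simp: codes_closed_def code_justified_def)
  then show ?case
  proof cases
    case 1 then show ?thesis using c by (intro exI[of _ Zero]) simp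
  next
    case 2 then show ?thesis using c by (intro exI[of _ Succ]) simp
  next
    case 3 then show ?thesis using c by (intro exI[of _ "Proj a"]) simp
  next
    case 4
    define cs where "cs = list_decode (psnd a)"
    have cs: "psnd a = list_encode cs" by (simp add: cs_def)
    have "\<exists>f. rec_code f = cs ! i" if "i < length cs" for i
    proof (rule sub)
      show "cs ! i \<le> a" using nth_le_list_encode[OF that] a cs by simp
    qed (use 4 that cs in auto)
    then obtain g where g: "\<And>i. i < length cs \<Longrightarrow> rec_code (g i) = cs ! i" by metis
    from 4 a sub obtain f where "rec_code f = pfst a" by force
    moreover have "list_encode (map rec_code (map g [0..<length cs])) = psnd a"
      unfolding cs by (rule arg_cong[of _ _ list_encode]) (auto intro: nth_equalityI simp: g)
    ultimately have "rec_code (Comp f (map g [0..<length cs])) = c" using 4 c by simp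
    then show ?thesis ..
  next
    case 5
    with a sub obtain f g where "rec_code f = pfst a" "rec_code g = psnd a" by (metis zero_less_numeral)
    then have "rec_code (PrimRec f g) = c" using 5 c by simp
    then show ?thesis ..
  next
    case 6
    with sub obtain f where "rec_code f = a" by force
    then have "rec_code (Mu f) = c" using 6 c by simp
    then show ?thesis ..
  qed
qed

lemma codes_closed_complete: "\<exists>V. finite V \<and> codes_closed V \<and> rec_code f \<in> V"
proof -
  have extend: "\<exists>V. finite V \<and> codes_closed V \<and> c \<in> V"
    if "finite V" "codes_closed V" "code_justified V c" for V c
    using codes_closed_insert[OF that(2,3)] that(1) by (intro exI[of _ "insert c V"]) simp
  show ?thesis
  proof (induction f)
    case Zero show ?case by (rule extend[of "{}"]) (auto simp: codes_closed_def code_justified_def)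
  next
    case Succ show ?case by (rule extend[of "{}"]) (auto simp: codes_closed_def code_justified_def)
  next
    case (Proj i) show ?case by (rule extend[of "{}"]) (auto simp: codes_closed_def code_justified_def)
  next
    case (Comp f gs)
    then obtain V W where V: "finite V" "codes_closed V" "rec_code f \<in> V"
      and W: "\<And>g. g \<in> set gs \<Longrightarrow> finite (W g) \<and> codes_closed (W g) \<and> rec_code g \<in> W g" by metis
    let ?U = "\<Union>(insert V (W ` set gs))"
    show ?case
    proof (rule extend)
      show "codes_closed ?U" by (rule codes_closed_Union) (use V W in auto)
      have "rec_code (gs ! i) \<in> ?U" if "i < length gs" for i using W[of "gs ! i"] that by force
      then show "code_justified ?U (rec_code (Comp f gs))"
        using V(3) by (simp add: code_justified_def)
    qed (use V W in auto)
  next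
    case (PrimRec f g)
    then obtain V W where V: "finite V" "codes_closed V" "rec_code f \<in> V"
      "finite W" "codes_closed W" "rec_code g \<in> W" by metis
    show ?case
    proof (rule extend)
      show "codes_closed (\<Union>{V, W})" by (rule codes_closed_Union) (use V in auto)
    qed (use V in \<open>auto simp: code_justified_def\<close>)
  next
    case (Mu f)
    then obtain V where V: "finite V" "codes_closed V" "rec_code f \<in> V" by metis
    then show ?case by (intro extend[of V]) (auto simp: code_justified_def)
  qed
qed

section \<open>Semidecidable predicates\<close>

definition semidecidable :: "(nat \<Rightarrow> bool) \<Rightarrow> bool" where
  "semidecidable P \<longleftrightarrow> (\<exists>Q. decidable Q \<and> (\<forall>x. P x \<longleftrightarrow> (\<exists>s. Q (pair s x))))"

lemma semidecidableI:
  "decidable (\<lambda>z. Q (pfst z) (psnd z)) \<Longrightarrow> semidecidable (\<lambda>x. \<exists>s. Q s x)"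
  unfolding semidecidable_def by (intro exI[of _ "\<lambda>z. Q (pfst z) (psnd z)"]) simp

lemma semidecidableE:
  assumes "semidecidable P"
  obtains Q where "decidable (\<lambda>z. Q (pfst z) (psnd z))" "\<And>x. P x \<longleftrightarrow> (\<exists>s. Q s x)"
proof -
  from assms obtain Q where Q: "decidable Q" "\<forall>x. P x \<longleftrightarrow> (\<exists>s. Q (pair s x))"
    unfolding semidecidable_def by blast
  show thesis by (rule that[of "\<lambda>s x. Q (pair s x)"]) (use Q in auto)
qed

lemma semidecidable_cong:
  assumes "semidecidable P" "\<And>x. P x \<longleftrightarrow> Q x" shows "semidecidable Q"
  using assms(1) ext[of P Q, OF assms(2)] by simp

lemma decidable_imp_semidecidable: "decidable P \<Longrightarrow> semidecidable P"
  using semidecidableI[of "\<lambda>_. P"] decidable_comp[of P psnd] recursive_psnd by simp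

lemma semidecidable_comp:
  assumes "semidecidable P" "recursive f" shows "semidecidable (\<lambda>x. P (f x))"
proof -
  obtain Q where Q: "decidable (\<lambda>z. Q (pfst z) (psnd z))" "\<And>x. P x \<longleftrightarrow> (\<exists>s. Q s x)"
    using semidecidableE[OF assms(1)] by metis
  have "decidable (\<lambda>z. Q (pfst z) (f (psnd z)))"
    using decidable_comp[OF Q(1), of "\<lambda>z. pair (pfst z) (f (psnd z))"]
    by (simp add: recursive_intros recursive_comp[OF assms(2)])
  then show ?thesis unfolding Q(2) by (rule semidecidableI)
qed

text \<open>Two existential quantifiers contract to one over pairs.\<close>

lemma semidecidable_ex:
  assumes "semidecidable (\<lambda>z. P (pfst z) (psnd z))" shows "semidecidable (\<lambda>x. \<exists>n. P n x)"
proof -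
  obtain Q where Q: "decidable (\<lambda>z. Q (pfst z) (psnd z))"
    "\<And>z. P (pfst z) (psnd z) \<longleftrightarrow> (\<exists>s. Q s z)"
    using semidecidableE[OF assms] by metis
  have "decidable (\<lambda>z. Q (pfst (pfst z)) (pair (psnd (pfst z)) (psnd z)))"
    using decidable_comp[OF Q(1), of "\<lambda>z. pair (pfst (pfst z)) (pair (psnd (pfst z)) (psnd z))"]
    by (simp add: recursive_intros)
  then have "semidecidable (\<lambda>x. \<exists>w. Q (pfst w) (pair (psnd w) x))" by (rule semidecidableI)
  then show ?thesis
  proof (rule semidecidable_cong)
    fix x
    show "(\<exists>w. Q (pfst w) (pair (psnd w) x)) \<longleftrightarrow> (\<exists>n. P n x)"
      using Q(2)[of "pair _ x"] by simp (metis fst_conv prod_encode_inverse snd_conv)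
  qed
qed

lemma semidecidable_conj:
  assumes "semidecidable P" "semidecidable Q" shows "semidecidable (\<lambda>x. P x \<and> Q x)"
proof -
  obtain R where R: "decidable (\<lambda>z. R (pfst z) (psnd z))" "\<And>x. P x \<longleftrightarrow> (\<exists>s. R s x)"
    using semidecidableE[OF assms(1)] by metis
  obtain S where S: "decidable (\<lambda>z. S (pfst z) (psnd z))" "\<And>x. Q x \<longleftrightarrow> (\<exists>s. S s x)"
    using semidecidableE[OF assms(2)] by metis
  have "decidable (\<lambda>z. R (pfst (pfst z)) (psnd z) \<and> S (psnd (pfst z)) (psnd z))"
    using decidable_comp[OF R(1), of "\<lambda>z. pair (pfst (pfst z)) (psnd z)"]
      decidable_comp[OF S(1), of "\<lambda>z. pair (psnd (pfst z)) (psnd z)"]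
    by (intro decidable_conj) (simp_all add: recursive_intros)
  then have "semidecidable (\<lambda>x. \<exists>w. R (pfst w) x \<and> S (psnd w) x)" by (rule semidecidableI)
  then show ?thesis
    by (rule semidecidable_cong) (use R S in \<open>metis fst_conv prod_encode_inverse snd_conv\<close>)
qed

section \<open>Convergence and the halting set\<close>

text \<open>For a code \<open>e\<close> this is convergence of the term with code \<open>e\<close> on \<open>[x]\<close>, where \<open>code_cons x 0\<close> is the
  code of \<open>[x]\<close>; for other \<open>e\<close> it is an accidental but still c.e. condition.\<close>

definition converges :: "nat \<Rightarrow> nat \<Rightarrow> bool" where
  "converges e x \<longleftrightarrow> (\<exists>u y. certificate (set_decode u) \<and> triple e (code_cons x 0) y \<in> set_decode u)"

lemma converges_rec_code: "converges (rec_code f) x \<longleftrightarrow> (\<exists>y. rec_eval f [x] y)"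
proof
  assume "converges (rec_code f) x"
  then obtain u y where "certificate (set_decode u)"
    "triple (rec_code f) (list_encode [x]) y \<in> set_decode u"
    unfolding converges_def code_cons_def by auto
  then show "\<exists>y. rec_eval f [x] y" using certificate_sound by blast
next
  assume "\<exists>y. rec_eval f [x] y"
  then obtain S y where "finite S" "certificate S" "triple (rec_code f) (code_cons x 0) y \<in> S"
    using rec_eval_certified unfolding certified_def code_cons_def by (metis list_encode.simps)
  then show "converges (rec_code f) x"
    unfolding converges_def by (intro exI[of _ "set_encode S"] exI[of _ y]) simp
qed

lemma decidable_certificate: "recursive u \<Longrightarrow> decidable (\<lambda>x. certificate (set_decode (u x)))"
  unfolding certificate_def
  by (intro decidable_ball_set_decode decidable_step_justified recursive_intros)
    (erule recursive_comp, intro recursive_intros)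

lemma semidecidable_converges:
  assumes "recursive e" "recursive x" shows "semidecidable (\<lambda>z. converges (e z) (x z))"
  unfolding converges_def
  by (intro semidecidable_ex decidable_imp_semidecidable decidable_conj decidable_certificate
      code_intros assms[THEN recursive_comp])

text \<open>Kleene's normal form in one direction, and unbounded search in the other.\<close>

lemma ce_set_iff_semidecidable: "ce_set A \<longleftrightarrow> semidecidable (\<lambda>x. x \<in> A)"
proof
  assume "ce_set A"
  then obtain f where "\<And>x. x \<in> A \<longleftrightarrow> converges (rec_code f) x"
    unfolding ce_set_def converges_rec_code by blast
  then show "semidecidable (\<lambda>x. x \<in> A)"
    using semidecidable_converges[OF recursive_const recursive_id] by simp
next
  assume "semidecidable (\<lambda>x. x \<in> A)"
  from semidecidableE[OF this] obtain Q
    where Q: "decidable (\<lambda>z. Q (pfst z) (psnd z))" "\<And>x. x \<in> A \<longleftrightarrow> (\<exists>s. Q s x)" by metis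
  have "recursive2 (\<lambda>s x. if Q s x then 0 else 1)"
    by (intro recursive2I recursive_if Q(1) recursive_const)
  then obtain f where f: "\<And>s x. rec_eval f [s, x] (if Q s x then 0 else 1)"
    unfolding recursive2_def computable_fun_def by (metis One_nat_def length_Cons list.size(3) nth_Cons_0 nth_Cons_Suc Suc_1)
  have "(\<exists>y. rec_eval (Mu f) [x] y) \<longleftrightarrow> (\<exists>s. Q s x)" for x
  proof
    assume "\<exists>y. rec_eval (Mu f) [x] y"
    then obtain s where "rec_eval f [s, x] 0" by (auto elim: rec_eval.cases)
    with f[of s x] have "(if Q s x then 0 else 1) = (0::nat)" by (rule rec_eval_deterministic)
    then show "\<exists>s. Q s x" by (metis zero_neq_one)
  next
    assume "\<exists>s. Q s x"
    define s where "s = (LEAST s. Q s x)"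
    have "Q s x" unfolding s_def using \<open>\<exists>s. Q s x\<close> by (rule LeastI_ex)
    moreover have "\<not> Q m x" if "m < s" for m using that not_less_Least unfolding s_def by blast
    ultimately have "rec_eval (Mu f) [x] s"
      using f[of s x] f[of _ x] by (intro eval_Mu) (auto, metis One_nat_def)
    then show "\<exists>y. rec_eval (Mu f) [x] y" ..
  qed
  then show "ce_set A" unfolding ce_set_def Q(2) by blast
qed

lemma ce_halting_set: "ce_set halting_set"
proof -
  have "semidecidable (\<lambda>e. (\<exists>v. codes_closed (set_decode v) \<and> e \<in> set_decode v) \<and> converges e e)"
    unfolding codes_closed_def code_justified_def
    by (intro semidecidable_conj semidecidable_ex semidecidable_converges
        decidable_imp_semidecidable code_intros)
  moreover have "(\<exists>v. codes_closed (set_decode v) \<and> e \<in> set_decode v) \<longleftrightarrow> (\<exists>f. rec_code f = e)" for e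
    using codes_closed_sound codes_closed_complete by (metis set_encode_inverse)
  ultimately show ?thesis
    unfolding ce_set_iff_semidecidable
    by (elim semidecidable_cong) (auto simp: halting_set_def converges_rec_code)
qed

lemma not_ce_compl_halting_set: "\<not> ce_set (- halting_set)"
proof
  assume "ce_set (- halting_set)"
  then obtain f where f: "\<And>x. x \<in> - halting_set \<longleftrightarrow> (\<exists>y. rec_eval f [x] y)"
    unfolding ce_set_def by blast
  have "rec_code f \<in> halting_set \<longleftrightarrow> (\<exists>y. rec_eval f [rec_code f] y)"
    unfolding halting_set_def using rec_code_inject by blast
  with f[of "rec_code f"] show False by blast
qed

section \<open>Arithmetical predicates\<close>

abbreviation arith :: "(nat \<Rightarrow> bool) \<Rightarrow> bool" where
  "arith P \<equiv> arithmetical {x. P x}"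

lemma Sigma_rel_SucI:
  "Sigma_rel n (Suc k) Q \<Longrightarrow> (\<And>xs. length xs = k \<Longrightarrow> P xs \<longleftrightarrow> (\<exists>y. \<not> Q (y # xs))) \<Longrightarrow>
    Sigma_rel (Suc n) k P"
  by auto

lemma computable_rel_iff: "computable_rel k P \<longleftrightarrow> computable_fun k (\<lambda>xs. if P xs then 1 else 0)"
  by (simp add: computable_rel_def computable_fun_def)

lemma computable_rel_not: "computable_rel k P \<Longrightarrow> computable_rel k (\<lambda>xs. \<not> P xs)"
proof -
  have "recursive (\<lambda>x. 1 - x)" by (intro recursive_intros)
  moreover assume "computable_rel k P"
  ultimately have "computable_fun k (\<lambda>xs. 1 - (if P xs then 1 else 0))"
    unfolding computable_rel_iff by (rule computable_fun_recursive)
  then show ?thesis unfolding computable_rel_iff by (rule computable_fun_cong) auto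
qed

lemma computable_fun_tl:
  assumes "computable_fun k g" shows "computable_fun (Suc k) (\<lambda>xs. g (tl xs))"
proof -
  have "computable_fun (Suc k) (\<lambda>xs. g (map (\<lambda>h. h xs) (map (\<lambda>i xs. xs ! Suc i) [0..<k])))"
    using assms by (rule computable_fun_comp) (auto intro: computable_fun_nth)
  then show ?thesis
  proof (rule computable_fun_cong)
    fix xs :: "nat list" assume "length xs = Suc k"
    then have "map (\<lambda>h. h xs) (map (\<lambda>i xs. xs ! Suc i) [0..<k]) = tl xs"
      by (intro nth_equalityI) (auto simp: nth_tl)
    then show "g (map (\<lambda>h. h xs) (map (\<lambda>i xs. xs ! Suc i) [0..<k])) = g (tl xs)" by simp
  qed
qed

lemma computable_rel_tl: "computable_rel k P \<Longrightarrow> computable_rel (Suc k) (\<lambda>xs. P (tl xs))"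
  unfolding computable_rel_iff by (rule computable_fun_tl)

text \<open>In the induction step the bound variable is a new first argument, so the substitution is extended by
  the first projection and shifted.\<close>

lemma Sigma_rel_subst:
  assumes "Sigma_rel n m P" "length gs = m" "\<And>g. g \<in> set gs \<Longrightarrow> computable_fun k g"
  shows "Sigma_rel n k (\<lambda>xs. P (map (\<lambda>g. g xs) gs))"
  using assms
proof (induction n arbitrary: m P gs k)
  case 0
  then show ?case using computable_fun_comp[of m "\<lambda>xs. if P xs then 1 else 0" gs k]
    by (simp add: computable_rel_iff)
next
  case (Suc n)
  from Suc.prems(1) obtain Q where Q: "Sigma_rel n (Suc m) Q"
    "\<And>xs. length xs = m \<Longrightarrow> P xs \<longleftrightarrow> (\<exists>y. \<not> Q (y # xs))" by auto
  let ?gs = "(\<lambda>xs. xs ! 0) # map (\<lambda>g xs. g (tl xs)) gs"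
  have "Sigma_rel n (Suc k) (\<lambda>xs. Q (map (\<lambda>g. g xs) ?gs))"
    by (rule Suc.IH[OF Q(1)]) (use Suc.prems(2,3) computable_fun_tl computable_fun_nth in auto)
  then show ?case
    by (rule Sigma_rel_SucI) (use Q(2)[of "map (\<lambda>g. g _) gs"] Suc.prems(2) in \<open>simp add: o_def\<close>)
qed

lemma Sigma_rel_Suc: "Sigma_rel n k P \<Longrightarrow> Sigma_rel (Suc n) k P"
proof (induction n arbitrary: k P)
  case 0
  then have "Sigma_rel 0 (Suc k) (\<lambda>xs. \<not> P (tl xs))"
    by (simp add: computable_rel_tl computable_rel_not)
  then show ?case by (rule Sigma_rel_SucI) simp
next
  case (Suc n)
  then obtain Q where Q: "Sigma_rel n (Suc k) Q"
    "\<forall>xs. length xs = k \<longrightarrow> P xs = (\<exists>y. \<not> Q (y # xs))" by auto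
  from Suc.IH[OF Q(1)] Q(2) show ?case by (intro Sigma_rel_SucI[of "Suc n"]) blast+
qed

lemma Sigma_rel_mono: "n \<le> m \<Longrightarrow> Sigma_rel n k P \<Longrightarrow> Sigma_rel m k P"
  by (induction rule: dec_induct) (auto simp del: Sigma_rel.simps intro: Sigma_rel_Suc)

text \<open>A computable case distinction commutes with the quantifiers, so it needs a computation only on the
  matrices. It yields joins directly, and conjunctions because \<open>P \<and> Q\<close> says that the distinction comes
  out true in both cases.\<close>

lemma Sigma_rel_if:
  assumes "Sigma_rel n k P" "Sigma_rel n k Q" "computable_rel k c"
  shows "Sigma_rel n k (\<lambda>xs. if c xs then P xs else Q xs)"
  using assms
proof (induction n arbitrary: k P Q c)
  case 0
  let ?b = "\<lambda>P xs. if P xs then 1 else 0 :: nat"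
  have "recursive2 (\<lambda>x y. x * y)" "recursive2 (\<lambda>x y. x + y)" "recursive (\<lambda>x. 1 - x)"
    using recursive2_mult recursive2_add recursive_diff[OF recursive_const recursive_id] by auto
  from computable_fun_recursive2[OF this(2) computable_fun_recursive2[OF this(1), of k "?b c" "?b P"]
      computable_fun_recursive2[OF this(1) computable_fun_recursive[OF this(3), of k "?b c"], of "?b Q"]]
  have "computable_fun k (\<lambda>xs. ?b c xs * ?b P xs + (1 - ?b c xs) * ?b Q xs)"
    using 0 by (simp add: computable_rel_iff)
  then have "computable_fun k (\<lambda>xs. if (if c xs then P xs else Q xs) then 1 else 0)"
    by (rule computable_fun_cong) auto
  then show ?case by (simp add: computable_rel_iff)
next
  case (Suc n)
  from Suc.prems obtain P' where P': "Sigma_rel n (Suc k) P'"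
    "\<forall>xs. length xs = k \<longrightarrow> P xs = (\<exists>y. \<not> P' (y # xs))" by auto
  from Suc.prems obtain Q' where Q': "Sigma_rel n (Suc k) Q'"
    "\<forall>xs. length xs = k \<longrightarrow> Q xs = (\<exists>y. \<not> Q' (y # xs))" by auto
  have "Sigma_rel n (Suc k) (\<lambda>xs. if c (tl xs) then P' xs else Q' xs)"
    by (rule Suc.IH[OF P'(1) Q'(1) computable_rel_tl[OF Suc.prems(3)]])
  then show ?case by (rule Sigma_rel_SucI) (use P'(2) Q'(2) in simp)
qed

lemma arith_cong: "arith P \<Longrightarrow> (\<And>x. P x \<longleftrightarrow> Q x) \<Longrightarrow> arith Q"
  by simp

lemma decidable_imp_arith: "decidable P \<Longrightarrow> arith P"
  unfolding arithmetical_def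
  by (rule exI[of _ 0]) (simp add: decidable_def recursive_def computable_rel_iff)

lemma arith_comp:
  assumes "arith P" "recursive f" shows "arith (\<lambda>x. P (f x))"
  using assms Sigma_rel_subst[of _ 1 "\<lambda>xs. P (xs ! 0)" "[\<lambda>xs. f (xs ! 0)]" 1]
  by (auto simp: arithmetical_def recursive_def)

lemma arith_not: "arith P \<Longrightarrow> arith (\<lambda>x. \<not> P x)"
proof -
  assume "arith P"
  then obtain n where n: "Sigma_rel n 1 (\<lambda>xs. P (xs ! 0))" by (auto simp: arithmetical_def)
  then have "Sigma_rel n 2 (\<lambda>xs. P (xs ! 1))"
    using Sigma_rel_subst[of n 1 "\<lambda>xs. P (xs ! 0)" "[\<lambda>xs. xs ! 1]" 2] by (simp add: computable_fun_nth)
  then have "Sigma_rel (Suc n) 1 (\<lambda>xs. \<not> P (xs ! 0))"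
    by (intro Sigma_rel_SucI[of n 1 "\<lambda>xs. P (xs ! 1)"]) (simp_all add: numeral_2_eq_2)
  then show ?thesis unfolding arithmetical_def by (intro exI[of _ "Suc n"]) simp
qed

text \<open>The successor step of the hierarchy projects a negation, so \<open>P\<close> is first written as \<open>\<not> \<not> P\<close>. Each
  of the two steps adds a level, which makes it unnecessary to contract quantifiers.\<close>

lemma arith_ex:
  assumes "arith (\<lambda>z. P (pfst z) (psnd z))" shows "arith (\<lambda>x. \<exists>n. P n x)"
proof -
  from arith_not[OF assms] obtain k
    where k: "Sigma_rel k 1 (\<lambda>xs. \<not> P (pfst (xs ! 0)) (psnd (xs ! 0)))"
    by (auto simp: arithmetical_def)
  have "recursive2 (\<lambda>x y. pair x y)" by (rule recursive2I) (simp add: recursive_id)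
  then have "computable_fun 2 (\<lambda>xs. pair (xs ! 0) (xs ! 1))" by (simp add: recursive2_def)
  with Sigma_rel_subst[OF k, of "[\<lambda>xs. pair (xs ! 0) (xs ! 1)]" 2]
  have "Sigma_rel k 2 (\<lambda>xs. \<not> P (xs ! 0) (xs ! 1))" by simp
  then have "Sigma_rel (Suc k) 1 (\<lambda>xs. \<exists>n. P n (xs ! 0))"
    by (intro Sigma_rel_SucI[of k 1 "\<lambda>xs. \<not> P (xs ! 0) (xs ! 1)"]) (simp_all add: numeral_2_eq_2)
  then show ?thesis unfolding arithmetical_def by (intro exI[of _ "Suc k"]) simp
qed

lemma arith_all:
  assumes "arith (\<lambda>z. P (pfst z) (psnd z))" shows "arith (\<lambda>x. \<forall>n. P n x)"
  using arith_not[OF arith_ex[OF arith_not[OF assms]]] by simp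

lemma arith_if:
  assumes "decidable c" "arith P" "arith Q" shows "arith (\<lambda>x. if c x then P x else Q x)"
proof -
  obtain n m where "Sigma_rel n 1 (\<lambda>xs. P (xs ! 0))" "Sigma_rel m 1 (\<lambda>xs. Q (xs ! 0))"
    using assms by (auto simp: arithmetical_def)
  then have "Sigma_rel (max n m) 1 (\<lambda>xs. P (xs ! 0))" "Sigma_rel (max n m) 1 (\<lambda>xs. Q (xs ! 0))"
    by (auto intro: Sigma_rel_mono[rotated])
  moreover have "computable_rel 1 (\<lambda>xs. c (xs ! 0))"
    using assms(1) by (simp add: decidable_def recursive_def computable_rel_iff)
  ultimately have "Sigma_rel (max n m) 1 (\<lambda>xs. if c (xs ! 0) then P (xs ! 0) else Q (xs ! 0))"
    by (rule Sigma_rel_if)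
  then show ?thesis unfolding arithmetical_def by (intro exI[of _ "max n m"]) simp
qed

lemma arith_conj:
  assumes "arith P" "arith Q" shows "arith (\<lambda>x. P x \<and> Q x)"
proof -
  have "arith (\<lambda>x. \<forall>b::nat. if b = 0 then P x else Q x)"
    by (intro arith_all arith_if decidable_eq recursive_intros arith_comp[OF assms(1)]
      arith_comp[OF assms(2)])
  then show ?thesis by (rule arith_cong) (use zero_neq_one in metis)
qed

lemma arith_imp: "arith P \<Longrightarrow> arith Q \<Longrightarrow> arith (\<lambda>x. P x \<longrightarrow> Q x)"
  using arith_not[OF arith_conj[OF _ arith_not, of P Q]] by simp

lemma arith_iff: "arith P \<Longrightarrow> arith Q \<Longrightarrow> arith (\<lambda>x. P x \<longleftrightarrow> Q x)"
  using arith_conj[OF arith_imp arith_imp, of P Q Q P] by (simp add: iff_conv_conj_imp)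

lemma semidecidable_imp_arith:
  assumes "semidecidable P" shows "arith P"
proof -
  obtain Q where Q: "decidable (\<lambda>z. Q (pfst z) (psnd z))" "\<And>x. P x \<longleftrightarrow> (\<exists>s. Q s x)"
    using semidecidableE[OF assms] by metis
  show ?thesis unfolding Q(2) by (intro arith_ex decidable_imp_arith Q(1))
qed

lemma mem_set_join: "n \<in> A \<oplus> B \<longleftrightarrow> (if even n then n div 2 \<in> A else n div 2 \<in> B)"
  unfolding set_join_def by (auto elim!: evenE oddE) presburger+

lemma arithmetical_set_join:
  assumes "arithmetical A" "arithmetical B" shows "arithmetical (A \<oplus> B)"
proof -
  have "arith (\<lambda>x. if even x then x div 2 \<in> A else x div 2 \<in> B)"
    using arith_comp[of "\<lambda>x. x \<in> A" "\<lambda>x. x div 2"] arith_comp[of "\<lambda>x. x \<in> B" "\<lambda>x. x div 2"] assms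
    by (intro arith_if decidable_even recursive_id) (simp_all add: recursive_div2 recursive_id)
  then show ?thesis by (rule arith_cong[of _ "\<lambda>x. x \<in> A \<oplus> B", simplified]) (simp add: mem_set_join)
qed

section \<open>Kalimullin pairs\<close>

text \<open>\<open>A\<close> and \<open>B\<close> form a Kalimullin pair if \<open>R\<close> can be chosen c.e.; the lemmas below take \<open>R\<close> decidable.\<close>

definition K_pair :: "(nat \<Rightarrow> nat \<Rightarrow> bool) \<Rightarrow> nat set \<Rightarrow> nat set \<Rightarrow> bool" where
  "K_pair R A B \<longleftrightarrow> (\<forall>a\<in>A. \<forall>b\<in>B. R a b) \<and> (\<forall>a\<in>-A. \<forall>b\<in>-B. \<not> R a b)"

lemma e_le_iff:
  "A \<le>\<^sub>e B \<longleftrightarrow> (\<exists>W. semidecidable (\<lambda>z. W (pfst z) (psnd z)) \<and>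
    (\<forall>x. x \<in> A \<longleftrightarrow> (\<exists>u. W x u \<and> set_decode u \<subseteq> B)))"
proof
  assume "A \<le>\<^sub>e B"
  then obtain V where "ce_set V" "A = {x. \<exists>u. pair x u \<in> V \<and> set_decode u \<subseteq> B}"
    unfolding e_le_def enumeration_operator_def by blast
  then show "\<exists>W. semidecidable (\<lambda>z. W (pfst z) (psnd z)) \<and>
    (\<forall>x. x \<in> A \<longleftrightarrow> (\<exists>u. W x u \<and> set_decode u \<subseteq> B))"
    by (intro exI[of _ "\<lambda>x u. pair x u \<in> V"]) (simp add: ce_set_iff_semidecidable)
next
  assume "\<exists>W. semidecidable (\<lambda>z. W (pfst z) (psnd z)) \<and>
    (\<forall>x. x \<in> A \<longleftrightarrow> (\<exists>u. W x u \<and> set_decode u \<subseteq> B))"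
  then obtain W where W: "semidecidable (\<lambda>z. W (pfst z) (psnd z))"
    "\<And>x. x \<in> A \<longleftrightarrow> (\<exists>u. W x u \<and> set_decode u \<subseteq> B)" by blast
  let ?V = "{z. W (pfst z) (psnd z)}"
  have "ce_set ?V" using W(1) by (simp add: ce_set_iff_semidecidable)
  then have "enumeration_operator (\<lambda>B. {x. \<exists>u. pair x u \<in> ?V \<and> set_decode u \<subseteq> B})"
    unfolding enumeration_operator_def by blast
  moreover have "A = {x. \<exists>u. pair x u \<in> ?V \<and> set_decode u \<subseteq> B}" using W(2) by auto
  ultimately show "A \<le>\<^sub>e B" unfolding e_le_def by blast
qed

lemma e_le_empty_imp_ce:
  assumes "A \<le>\<^sub>e {}" shows "ce_set A"
proof -
  obtain W where W: "semidecidable (\<lambda>z. W (pfst z) (psnd z))"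
    "\<And>x. x \<in> A \<longleftrightarrow> (\<exists>u. W x u \<and> set_decode u \<subseteq> {})"
    using assms unfolding e_le_iff by blast
  have "x \<in> A \<longleftrightarrow> W x 0" for x
    using W(2) by (metis set_decode_inverse set_decode_zero subset_empty)
  moreover have "semidecidable (\<lambda>x. W x 0)"
    using semidecidable_comp[OF W(1), of "\<lambda>x. pair x 0"] by (simp add: recursive_intros)
  ultimately show ?thesis by (simp add: ce_set_iff_semidecidable)
qed

text \<open>Let \<open>V\<close> and \<open>W\<close> be the two reductions. An axiom of the new one puts \<open>x\<close> into \<open>Z\<close> if \<open>V\<close> and \<open>W\<close>
  have axioms for \<open>x\<close> whose \<open>C\<close>-parts are contained in the given finite set and whose parts for \<open>A\<close> and
  for \<open>B\<close> are related by \<open>R\<close> elementwise. If \<open>x \<in> Z\<close> then correct axioms are of this kind. Conversely,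
  of two axioms of this kind at least one is correct: if both were wrong, some \<open>a \<notin> A\<close> would be
  related to some \<open>b \<notin> B\<close>.\<close>

lemma K_pair_meet:
  assumes R: "decidable (\<lambda>z. R (pfst z) (psnd z))" and pair: "K_pair R A B"
    and A: "Z \<le>\<^sub>e A \<oplus> C" and B: "Z \<le>\<^sub>e B \<oplus> C"
  shows "Z \<le>\<^sub>e C"
proof -
  obtain V where V: "semidecidable (\<lambda>z. V (pfst z) (psnd z))"
    "\<And>x. x \<in> Z \<longleftrightarrow> (\<exists>u. V x u \<and> set_decode u \<subseteq> A \<oplus> C)"
    using A unfolding e_le_iff by blast
  obtain W where W: "semidecidable (\<lambda>z. W (pfst z) (psnd z))"
    "\<And>x. x \<in> Z \<longleftrightarrow> (\<exists>u. W x u \<and> set_decode u \<subseteq> B \<oplus> C)"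
    using B unfolding e_le_iff by blast
  define T where "T u v w \<longleftrightarrow>
    (\<forall>a\<in>set_decode u. odd a \<longrightarrow> a div 2 \<in> set_decode w) \<and>
    (\<forall>b\<in>set_decode v. odd b \<longrightarrow> b div 2 \<in> set_decode w) \<and>
    (\<forall>a\<in>set_decode u. \<forall>b\<in>set_decode v. even a \<longrightarrow> even b \<longrightarrow> R (a div 2) (b div 2))" for u v w
  have R': "decidable (\<lambda>x. R (f x) (g x))" if "recursive f" "recursive g" for f g
    using decidable_comp[OF R recursive_prod_encode[OF that]] by simp
  have V': "semidecidable (\<lambda>x. V (f x) (g x))" if "recursive f" "recursive g" for f g
    using semidecidable_comp[OF V(1) recursive_prod_encode[OF that]] by simp
  have W': "semidecidable (\<lambda>x. W (f x) (g x))" if "recursive f" "recursive g" for f g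
    using semidecidable_comp[OF W(1) recursive_prod_encode[OF that]] by simp
  show ?thesis
    unfolding e_le_iff
  proof (intro exI[of _ "\<lambda>x w. \<exists>u v. V x u \<and> W x v \<and> T u v w"] conjI allI iffI)
    show "semidecidable (\<lambda>z. \<exists>u v. V (pfst z) u \<and> W (pfst z) v \<and> T u v (psnd z))"
      unfolding T_def
      by (intro semidecidable_ex semidecidable_conj V' W';
          (intro decidable_imp_semidecidable)?; intro code_intros R')
  next
    fix x assume "x \<in> Z"
    then obtain u v where u: "V x u" "set_decode u \<subseteq> A \<oplus> C" and v: "W x v" "set_decode v \<subseteq> B \<oplus> C"
      using V(2) W(2) by blast
    let ?F = "(\<lambda>a. a div 2) ` {a \<in> set_decode u \<union> set_decode v. odd a}"
    have "finite ?F" by simp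
    then have F: "set_decode (set_encode ?F) = ?F" by (rule set_encode_inverse)
    have "R (a div 2) (b div 2)"
      if "a \<in> set_decode u" "b \<in> set_decode v" "even a" "even b" for a b
    proof -
      have "a \<in> A \<oplus> C" "b \<in> B \<oplus> C" using that u(2) v(2) by blast+
      then have "a div 2 \<in> A" "b div 2 \<in> B" using that by (simp_all add: mem_set_join)
      then show ?thesis using pair unfolding K_pair_def by blast
    qed
    then have "T u v (set_encode ?F)" unfolding T_def F by blast
    moreover have "a div 2 \<in> C" if "a \<in> set_decode u \<union> set_decode v" "odd a" for a
    proof -
      have "a \<in> A \<oplus> C \<or> a \<in> B \<oplus> C" using that(1) u(2) v(2) by blast
      then show ?thesis using that(2) by (simp add: mem_set_join)
    qed
    then have "set_decode (set_encode ?F) \<subseteq> C" unfolding F by blast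
    ultimately show "\<exists>w. (\<exists>u v. V x u \<and> W x v \<and> T u v w) \<and> set_decode w \<subseteq> C"
      using u(1) v(1) by blast
  next
    fix x assume "\<exists>w. (\<exists>u v. V x u \<and> W x v \<and> T u v w) \<and> set_decode w \<subseteq> C"
    then obtain u v w where uv: "V x u" "W x v" and T: "T u v w" and w: "set_decode w \<subseteq> C" by blast
    show "x \<in> Z"
    proof (rule ccontr)
      assume "x \<notin> Z"
      then have "\<not> set_decode u \<subseteq> A \<oplus> C" "\<not> set_decode v \<subseteq> B \<oplus> C" using V(2) W(2) uv by blast+
      then obtain a b where ab: "a \<in> set_decode u" "a \<notin> A \<oplus> C" "b \<in> set_decode v" "b \<notin> B \<oplus> C"
        by blast
      with T w have "even a" "even b" unfolding T_def mem_set_join by (meson subsetD)+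
      with ab T have "R (a div 2) (b div 2)" "a div 2 \<notin> A" "b div 2 \<notin> B"
        unfolding T_def mem_set_join by auto
      with pair show False unfolding K_pair_def by blast
    qed
  qed
qed

text \<open>Composing the reduction of \<open>Z\<close> to \<open>A\<close> with \<open>R\<close> gives a c.e. relation \<open>S\<close> that holds on \<open>Z \<times> B\<close> and
  fails on \<open>- Z \<times> - B\<close>. If some \<open>y \<in> B\<close> is related to no \<open>x \<notin> Z\<close>, then \<open>Z\<close> is the section of \<open>S\<close>
  at \<open>y\<close>. Otherwise \<open>B\<close> consists of the \<open>y\<close> that are related to some \<open>x \<notin> Z\<close>, and it is c.e. because
  \<open>- Z\<close> is.\<close>

lemma K_pair_not_above:
  assumes R: "decidable (\<lambda>z. R (pfst z) (psnd z))" and pair: "K_pair R A B"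
    and le: "Z \<le>\<^sub>e A" and co: "ce_set (- Z)" and B: "\<not> ce_set B"
  shows "ce_set Z"
proof -
  obtain V where V: "semidecidable (\<lambda>z. V (pfst z) (psnd z))"
    "\<And>x. x \<in> Z \<longleftrightarrow> (\<exists>u. V x u \<and> set_decode u \<subseteq> A)"
    using le unfolding e_le_iff by blast
  have V': "semidecidable (\<lambda>x. V (f x) (g x))" if "recursive f" "recursive g" for f g
    using semidecidable_comp[OF V(1) recursive_prod_encode[OF that]] by simp
  have R': "decidable (\<lambda>x. R (f x) (g x))" if "recursive f" "recursive g" for f g
    using decidable_comp[OF R recursive_prod_encode[OF that]] by simp
  define S where "S x y \<longleftrightarrow> (\<exists>u. V x u \<and> (\<forall>a\<in>set_decode u. R a y))" for x y
  have S: "semidecidable (\<lambda>z. S (f z) (g z))" if "recursive f" "recursive g" for f g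
    unfolding S_def
    by (intro semidecidable_ex semidecidable_conj V' decidable_imp_semidecidable;
        intro code_intros R' that[THEN recursive_comp])
  have SZ: "S x y" if "x \<in> Z" "y \<in> B" for x y
    using that V(2) pair unfolding S_def K_pair_def by blast
  have SnZ: "\<not> S x y" if "x \<notin> Z" "y \<notin> B" for x y
    using that V(2) pair unfolding S_def K_pair_def by blast
  have "\<exists>y\<in>B. \<forall>x. S x y \<longrightarrow> x \<in> Z"
  proof (rule ccontr)
    assume "\<not> ?thesis"
    then have "y \<in> B \<longleftrightarrow> (\<exists>x. x \<in> - Z \<and> S x y)" for y using SnZ by blast
    moreover have "semidecidable (\<lambda>y. \<exists>x. x \<in> - Z \<and> S x y)"
      using semidecidable_comp[OF co[unfolded ce_set_iff_semidecidable] recursive_pfst]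
      by (intro semidecidable_ex semidecidable_conj S recursive_psnd recursive_pfst)
    ultimately show False using B unfolding ce_set_iff_semidecidable by simp
  qed
  then obtain y where "x \<in> Z \<longleftrightarrow> S x y" for x using SZ by blast
  moreover have "semidecidable (\<lambda>x. S x y)" by (intro S recursive_id recursive_const)
  ultimately show ?thesis unfolding ce_set_iff_semidecidable by simp
qed

section \<open>Lexicographic cuts\<close>

text \<open>The order of the characteristic functions: the set that contains the least difference is the larger
  one.\<close>

definition lex_less :: "nat set \<Rightarrow> nat set \<Rightarrow> bool" where
  "lex_less D E \<longleftrightarrow> (\<exists>i. i \<in> E \<and> i \<notin> D \<and> (\<forall>j<i. j \<in> D \<longleftrightarrow> j \<in> E))"

lemma lex_less_trans: "lex_less D E \<Longrightarrow> lex_less E F \<Longrightarrow> lex_less D F"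
proof -
  assume "lex_less D E" "lex_less E F"
  then obtain i k where "i \<in> E" "i \<notin> D" "\<forall>j<i. j \<in> D \<longleftrightarrow> j \<in> E"
    "k \<in> F" "k \<notin> E" "\<forall>j<k. j \<in> E \<longleftrightarrow> j \<in> F"
    unfolding lex_less_def by blast
  then show ?thesis
    unfolding lex_less_def
    by (intro exI[of _ "min i k"]) (metis linorder_less_linear min.absorb3 min.absorb4 min_def min_less_iff_conj)
qed

lemma lex_less_irrefl: "\<not> lex_less D D"
  by (simp add: lex_less_def)

lemma lex_less_total: "D \<noteq> E \<Longrightarrow> lex_less D E \<or> lex_less E D"
proof -
  assume "D \<noteq> E"
  then have ex: "\<exists>i. \<not> (i \<in> D \<longleftrightarrow> i \<in> E)" by blast
  define i where "i = (LEAST i. \<not> (i \<in> D \<longleftrightarrow> i \<in> E))"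
  have "\<not> (i \<in> D \<longleftrightarrow> i \<in> E)" unfolding i_def using ex by (rule LeastI_ex)
  moreover have "\<forall>j<i. j \<in> D \<longleftrightarrow> j \<in> E" unfolding i_def using not_less_Least by blast
  ultimately show ?thesis unfolding lex_less_def by blast
qed

lemma decidable_lex_less:
  assumes "recursive f" "recursive g"
  shows "decidable (\<lambda>x. lex_less (set_decode (f x)) (set_decode (g x)))"
proof -
  have "decidable (\<lambda>x. \<exists>i<g x. i \<in> set_decode (g x) \<and> i \<notin> set_decode (f x) \<and>
      (\<forall>j<i. j \<in> set_decode (f x) \<longleftrightarrow> j \<in> set_decode (g x)))"
    by (intro code_intros assms[THEN recursive_comp] assms)
  then show ?thesis
    unfolding lex_less_def by (rule decidable_cong) (auto dest: mem_set_decode_less)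
qed

definition lower_cut :: "nat set \<Rightarrow> nat set" where
  "lower_cut X = {u. \<not> lex_less X (set_decode u)}"

text \<open>If \<open>u\<close> is in the cut of \<open>X\<close> and \<open>v\<close> is not, then \<open>D\<^sub>u \<le> X < D\<^sub>v\<close>; in the opposite case
  \<open>D\<^sub>v \<le> X < D\<^sub>u\<close>.\<close>

lemma K_pair_lower_cut:
  "K_pair (\<lambda>u v. lex_less (set_decode u) (set_decode v)) (lower_cut X) (- lower_cut X)"
  unfolding K_pair_def lower_cut_def
  by auto (metis lex_less_total lex_less_trans, metis lex_less_irrefl lex_less_total lex_less_trans)

lemma K_pair_commute: "K_pair R A B \<Longrightarrow> K_pair (\<lambda>a b. R b a) B A"
  unfolding K_pair_def by blast

text \<open>This asks whether \<open>n\<close> belongs to the lexicographically largest subset of \<open>{..n}\<close> with index in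
  \<open>S\<close>. If \<open>S\<close> is the cut of \<open>X\<close>, that subset is \<open>X \<inter> {..n}\<close>, so the cut gives back \<open>X\<close>.\<close>

definition last_bit :: "nat set \<Rightarrow> nat \<Rightarrow> bool" where
  "last_bit S n \<longleftrightarrow> (\<exists>u. u \<in> S \<and> set_decode u \<subseteq> {..n} \<and> n \<in> set_decode u \<and>
    (\<forall>v. v \<in> S \<longrightarrow> set_decode v \<subseteq> {..n} \<longrightarrow> \<not> lex_less (set_decode u) (set_decode v)))"

lemma last_bit_lower_cut: "last_bit (lower_cut X) n \<longleftrightarrow> n \<in> X"
proof -
  define u where "u = set_encode (X \<inter> {..n})"
  have u: "set_decode u = X \<inter> {..n}" unfolding u_def by (simp add: set_encode_inverse)
  have max: "\<not> lex_less (X \<inter> {..n}) D" if "D \<subseteq> {..n}" "\<not> lex_less X D" for D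
  proof
    assume "lex_less (X \<inter> {..n}) D"
    then obtain i where i: "i \<in> D" "i \<notin> X \<inter> {..n}" "\<forall>j<i. j \<in> X \<inter> {..n} \<longleftrightarrow> j \<in> D"
      unfolding lex_less_def by blast
    with that(1) have "i \<le> n" by auto
    with i have "lex_less X D" unfolding lex_less_def by (intro exI[of _ i]) auto
    with that(2) show False by blast
  qed
  have mem: "u \<in> lower_cut X" by (auto simp: lower_cut_def lex_less_def u)
  show ?thesis
  proof
    assume "last_bit (lower_cut X) n"
    then obtain w where w: "\<not> lex_less X (set_decode w)" "set_decode w \<subseteq> {..n}" "n \<in> set_decode w"
      "\<not> lex_less (set_decode w) (set_decode u)"
      using mem u unfolding last_bit_def lower_cut_def by blast
    then have "set_decode w = X \<inter> {..n}" using max lex_less_total u by metis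
    with w(3) show "n \<in> X" by blast
  next
    assume "n \<in> X"
    moreover have "\<forall>v. v \<in> lower_cut X \<longrightarrow> set_decode v \<subseteq> {..n} \<longrightarrow> \<not> lex_less (set_decode u) (set_decode v)"
      using max unfolding lower_cut_def u by blast
    ultimately show "last_bit (lower_cut X) n"
      unfolding last_bit_def using mem u by (intro exI[of _ u]) simp
  qed
qed

text \<open>The number \<open>n = pair e b\<close> is used against the set of all \<open>x\<close> on which \<open>e\<close> converges if \<open>b = 0\<close>, and
  against its complement otherwise: were it the cut of \<open>diagonal\<close>, it would give the wrong
  answer about \<open>n\<close>.\<close>

definition diagonal :: "nat set" where
  "diagonal = {n. \<not> last_bit {x. converges (pfst n) x \<longleftrightarrow> psnd n = 0} n}"

lemma arithmetical_diagonal: "arithmetical diagonal"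
proof -
  have c: "arith (\<lambda>x. converges (f x) (g x))" if "recursive f" "recursive g" for f g
    by (intro semidecidable_imp_arith semidecidable_converges that)
  have s: "decidable (\<lambda>x. set_decode (f x) \<subseteq> {..g x})" if "recursive f" "recursive g" for f g
  proof -
    have "decidable (\<lambda>x. \<forall>i\<in>set_decode (f x). i \<le> g x)"
      by (intro code_intros that[THEN recursive_comp] that)
    then show ?thesis by (rule decidable_cong) auto
  qed
  show ?thesis
    unfolding diagonal_def last_bit_def mem_Collect_eq
    by (intro arith_not arith_ex arith_all arith_conj arith_imp arith_iff c;
      (rule decidable_imp_arith)?; intro s decidable_lex_less code_intros)
qed

lemma not_ce_lower_cut_diagonal: "\<not> ce_set (lower_cut diagonal)" "\<not> ce_set (- lower_cut diagonal)"
proof -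
  have *: "lower_cut diagonal \<noteq> {x. converges e x \<longleftrightarrow> b = 0}" for e b :: nat
  proof
    assume "lower_cut diagonal = {x. converges e x \<longleftrightarrow> b = 0}"
    then have "pair e b \<in> diagonal \<longleftrightarrow> last_bit {x. converges e x \<longleftrightarrow> b = 0} (pair e b)"
      using last_bit_lower_cut by metis
    then show False by (simp add: diagonal_def)
  qed
  show "\<not> ce_set (lower_cut diagonal)"
  proof
    assume "ce_set (lower_cut diagonal)"
    then obtain f where "\<And>x. x \<in> lower_cut diagonal \<longleftrightarrow> converges (rec_code f) x"
      unfolding ce_set_def converges_rec_code by blast
    then show False using *[of "rec_code f" 0] by auto
  qed
  show "\<not> ce_set (- lower_cut diagonal)"
  proof
    assume "ce_set (- lower_cut diagonal)"
    then obtain f where "\<And>x. x \<in> - lower_cut diagonal \<longleftrightarrow> converges (rec_code f) x"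
      unfolding ce_set_def converges_rec_code by blast
    then show False using *[of "rec_code f" 1] by auto
  qed
qed

lemma arithmetical_lower_cut:
  assumes "arithmetical X" shows "arithmetical (lower_cut X)"
proof -
  have X: "arith (\<lambda>x. f x \<in> X)" if "recursive f" for f
    using arith_comp[of "\<lambda>x. x \<in> X" f] assms that by simp
  have D: "arith (\<lambda>x. f x \<in> set_decode (g x))" if "recursive f" "recursive g" for f g
    using that by (intro decidable_imp_arith decidable_mem_set_decode)
  have L: "arith (\<lambda>x. f x < g x)" if "recursive f" "recursive g" for f g
    using that by (intro decidable_imp_arith decidable_less)
  show ?thesis unfolding lower_cut_def lex_less_def
    by (intro arith_not arith_ex arith_all arith_conj arith_imp arith_iff X D L code_intros)
qed

lemma arithmetical_Compl: "arithmetical A \<Longrightarrow> arithmetical (- A)"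
  using arith_not[of "\<lambda>x. x \<in> A"] by (simp add: Compl_eq)

section \<open>A family that cannot be split\<close>

theorem corollary5p16:
  "\<not> splitting_class {A. arithmetical A \<and> \<not> (- halting_set) \<le>\<^sub>e A}"
proof
  let ?\<A> = "{A. arithmetical A \<and> \<not> (- halting_set) \<le>\<^sub>e A}"
  let ?R = "\<lambda>u v. lex_less (set_decode u) (set_decode v)"
  define L where "L = lower_cut diagonal"
  have pair: "K_pair ?R L (- L)" unfolding L_def by (rule K_pair_lower_cut)
  have pair': "K_pair (\<lambda>a b. ?R b a) (- L) L" using pair by (rule K_pair_commute)
  have R: "decidable (\<lambda>z. ?R (pfst z) (psnd z))" "decidable (\<lambda>z. ?R (psnd z) (pfst z))"
    by (intro decidable_lex_less recursive_pfst recursive_psnd)+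
  have nce: "\<not> ce_set L" "\<not> ce_set (- L)" unfolding L_def by (rule not_ce_lower_cut_diagonal)+
  have arL: "arithmetical L" "arithmetical (- L)"
    unfolding L_def by (intro arithmetical_Compl arithmetical_lower_cut arithmetical_diagonal)+
  have "\<not> - halting_set \<le>\<^sub>e L" "\<not> - halting_set \<le>\<^sub>e - L"
    using K_pair_not_above[OF R(1) pair, of "- halting_set"]
      K_pair_not_above[OF R(2) pair', of "- halting_set"]
      nce ce_halting_set not_ce_compl_halting_set by auto
  with arL have L: "{L, - L} \<subseteq> ?\<A>" by auto
  have "arithmetical {}"
    using decidable_imp_arith[OF decidable_const[of False]] by simp
  then have empty: "{} \<in> ?\<A>" using e_le_empty_imp_ce not_ce_compl_halting_set by auto
  have "{L, - L} \<subseteq> {B \<in> ?\<A>. \<not> B \<le>\<^sub>e {}}" using L nce e_le_empty_imp_ce by auto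
  moreover assume "splitting_class ?\<A>"
  ultimately obtain C where C: "C \<in> ?\<A>" "\<forall>B\<in>{L, - L}. B \<oplus> C \<notin> ?\<A>"
    using empty unfolding splitting_class_def by (meson finite.emptyI finite.insertI)
  then have "- halting_set \<le>\<^sub>e L \<oplus> C" "- halting_set \<le>\<^sub>e - L \<oplus> C"
    using arL arithmetical_set_join by auto
  from K_pair_meet[OF R(1) pair this] C(1) show False by simp
qed

end
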